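(* Let $n\geq 1$ and let $N=(N_1,\ldots,N_n)$ be a zero-mean Gaussian random vector in $\mathbb{R}^n$ with (symmetric positive semidefinite) covariance matrix $K=(K_{ij})_{1\le i,j\le n}$. Set $$Z=\max_{1\leq i\leq n}N_{i}-E\Big(\max_{1\leq i\leq n}N_{i}\Big),\qquad \sigma_{\max}^{2}:=\max_{i}K_{ii},\qquad \sigma_{\min}^{2}:=\min_{i,j}K_{ij},$$ and assume that $\min_{i,j}K_{ij}>0$. Then the law of $Z$ has a density $\rho$ with respect to Lebesgue measure, and for almost all $z\in\mathbb{R}$, $$\frac{E|Z|}{2\sigma_{\max}^{2}}\,\exp\left(-\frac{z^{2}}{2\sigma_{\min}^{2}}\right)\leq\rho(z)\leq\frac{E|Z|}{2\sigma_{\min}^{2}}\,\exp\left(-\frac{z^{2}}{2\sigma_{\max}^{2}}\right).$$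
   Context: "Density" means density with respect to Lebesgue measure on $\mathbb{R}$; "almost all" is with respect to Lebesgue measure. *)

theory Defs
  imports "HOL-Probability.Probability"
begin

text \<open>Real Gaussian random variables are allowed to be degenerate: variance 0 gives a Dirac law.\<close>

definition gaussian_var :: "'a measure \<Rightarrow> ('a \<Rightarrow> real) \<Rightarrow> bool" where
  "gaussian_var M X \<longleftrightarrow> X \<in> borel_measurable M \<and>
     ((\<exists>\<mu>. distr M borel X = return borel \<mu>) \<or>
      (\<exists>\<mu> \<sigma>. 0 < \<sigma> \<and> distributed M lborel X (\<lambda>x. ennreal (normal_density \<mu> \<sigma> x))))"

text \<open>A random vector is Gaussian when all linear combinations of its coordinates are Gaussian.
  Since these may be degenerate, a singular covariance matrix is permitted.\<close>

definition gaussian_vector :: "'a measure \<Rightarrow> ('a \<Rightarrow> real ^ 'n) \<Rightarrow> bool" where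
  "gaussian_vector M X \<longleftrightarrow> X \<in> borel_measurable M \<and> (\<forall>a. gaussian_var M (\<lambda>\<omega>. a \<bullet> X \<omega>))"

definition covariance_matrix :: "'a measure \<Rightarrow> ('a \<Rightarrow> real ^ 'n) \<Rightarrow> real ^ 'n ^ 'n" where
  "covariance_matrix M X =
     (\<chi> i j. \<integral>\<omega>. (X \<omega> $ i - (\<integral>\<eta>. X \<eta> $ i \<partial>M)) * (X \<omega> $ j - (\<integral>\<eta>. X \<eta> $ j \<partial>M)) \<partial>M)"

text \<open>\<open>var_max\<close> and \<open>var_min\<close> are the squares \<open>\<sigma>\<^sub>m\<^sub>a\<^sub>x\<^sup>2\<close> and
  \<open>\<sigma>\<^sub>m\<^sub>i\<^sub>n\<^sup>2\<close>; note that the latter runs over all entries, not only the diagonal.\<close>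

definition var_max :: "real ^ 'n ^ 'n \<Rightarrow> real" where
  "var_max K = Max (range (\<lambda>i. K $ i $ i))"

definition var_min :: "real ^ 'n ^ 'n \<Rightarrow> real" where
  "var_min K = Min (range (\<lambda>(i, j). K $ i $ j))"

definition max_coord :: "real ^ 'n \<Rightarrow> real" where
  "max_coord x = Max (range (\<lambda>i. x $ i))"

end

theory Submission
  imports Defs "HOL-Real_Asymp.Real_Asymp"
begin

text \<open>Let \<open>c\<close> and \<open>C\<close> be the least entry and the largest variance of the covariance matrix. For nondecreasing
  smooth \<open>\<phi>\<close>, the Gaussian covariance formula expresses \<open>E Z \<phi>(Z)\<close> as an average of \<open>\<phi>'(Z)\<close> times a
  covariance of two probability vectors, the gradients of a smooth approximation of the maximum; such a
  covariance lies in \<open>[c, C]\<close>. Hence \<open>c E \<phi>'(Z) \<le> E Z \<phi>(Z) \<le> C E \<phi>'(Z)\<close>. As \<open>E Z \<phi>(Z)\<close> is also the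
  integral of \<open>\<phi>'\<close> against the weight \<open>k(s) = E [Z; Z > s]\<close>, this compares the law of \<open>Z\<close> with the
  measure \<open>k(s) ds\<close>, so a density \<open>\<rho>\<close> exists and \<open>c \<rho> \<le> k \<le> C \<rho>\<close>. Taking \<open>\<phi>'(s) = s exp (s\<^sup>2/2C)\<close> and
  \<open>\<phi>'(s) = s exp (s\<^sup>2/2c)\<close> on an interval from \<open>0\<close> to \<open>t\<close> then bounds \<open>k(t)\<close> from above and below by
  Gaussians, with \<open>k(0) = E\<bar>Z\<bar>/2\<close>.\<close>

section \<open>Characteristic functions on Euclidean spaces\<close>

text \<open>Formally k' = -t \<rho>, so c \<rho> \<le> k \<le> C \<rho> reads -(t/c) k \<le> k'
  \<le> -(t/C) k for t > 0, and Gronwall's argument gives k(0) exp(-t^2/2c) \<le> k(t) \<le> k(0)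
  exp(-t^2/2C). Passing from k back to \<rho> costs the other constant, which is why prefactor and
  exponent of each bound carry opposite variances.

  On the Gaussian side the obstacle is a possibly singular covariance matrix: there may be no
  density on R^n to integrate by parts against. Two identities in law replace it. Splitting x into
  its regression on b \<bullet> x and an independent residual reduces integration by parts to the
  line; rotation invariance of two independent copies drives the interpolation behind the covariance
  formula. Both are checked on characteristic functions, hence the opening uniqueness theorem in
  several dimensions.

  All entries of the matrix matter for the lower constant, not only the variances, because the two
  gradients are taken at different points and are different probability vectors.\<close>

lemma weighted_char_uniqueness:
  fixes \<mu> \<nu> :: "'a measure" and w X :: "'a \<Rightarrow> real"
  assumes fin: "finite_measure \<mu>" "finite_measure \<nu>" and sets: "sets \<nu> = sets \<mu>"
    and w [measurable]: "w \<in> borel_measurable \<mu>" and w0: "\<And>x. 0 \<le> w x" and wB: "\<And>x. w x \<le> B"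
    and X [measurable]: "X \<in> borel_measurable \<mu>"
    and eq: "\<And>t. (CLINT x|\<mu>. w x * iexp (t * X x)) = (CLINT x|\<nu>. w x * iexp (t * X x))"
    and A [measurable]: "A \<in> sets borel"
  shows "(LINT x|\<mu>. w x * indicator A (X x)) = (LINT x|\<nu>. w x * indicator A (X x))"
proof -
  interpret \<mu>: finite_measure \<mu> by fact
  interpret \<nu>: finite_measure \<nu> by fact
  have w' [measurable]: "w \<in> borel_measurable \<nu>" and X' [measurable]: "X \<in> borel_measurable \<nu>"
    using w X sets measurable_cong_sets by blast+
  have int: "integrable \<mu> w" "integrable \<nu> w"
    by (auto intro!: \<mu>.integrable_const_bound[where B = B] \<nu>.integrable_const_bound[where B = B]
        simp: w0 wB)
  define m where "m = (LINT x|\<mu>. w x)"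
  have m: "m = (LINT x|\<nu>. w x)"
    using eq[of 0] unfolding m_def by simp
  show ?thesis
  proof (cases "m = 0")
    \<comment> \<open>Zero total weight cannot be normalised, but then \<open>w\<close> vanishes
      almost everywhere for both measures.\<close>
    case True
    have "AE x in \<mu>. w x = 0" "AE x in \<nu>. w x = 0"
      using True m int w0 by (simp_all flip: integral_nonneg_eq_0_iff_AE add: m_def)
    then have "(LINT x|\<mu>. w x * indicator A (X x)) = 0" "(LINT x|\<nu>. w x * indicator A (X x)) = 0"
      by (auto intro!: integral_eq_zero_AE)
    then show ?thesis by simp
  next
    case False
    then have mp: "m > 0"
      unfolding m_def using w0 by (simp add: order.not_eq_order_implies_strict)
    \<comment> \<open>The law of \<open>X\<close> under the measure reweighted by
      \<open>w / m\<close>. Its characteristic function is the weighted transform divided by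
      \<open>m\<close>, and \<open>m\<close> is common to both measures by the case t = 0, so
      one-dimensional Levy uniqueness applies.\<close>
    define L where "L M = distr (density M (\<lambda>x. ennreal (w x / m))) borel X" for M
    have *: "real_distribution (L M)" "char (L M) t = (CLINT x|M. w x * iexp (t * X x)) / m"
      "measure (L M) A = (LINT x|M. w x * indicator A (X x)) / m"
      if "finite_measure M" "w \<in> borel_measurable M" "X \<in> borel_measurable M"
        "integrable M w" "(LINT x|M. w x) = m" for M t
    proof -
      interpret finite_measure M by fact
      note [measurable] = that(2,3)
      have [measurable]: "X \<in> measurable (density M (\<lambda>x. ennreal (w x / m))) borel"
        by measurable
      have "emeasure (density M (\<lambda>x. ennreal (w x / m))) (space M) = (\<integral>\<^sup>+ x. ennreal (w x / m) \<partial>M)"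
        by (subst emeasure_density) (auto intro!: nn_integral_cong)
      also have "\<dots> = ennreal (LINT x|M. w x / m)"
        using that mp w0 by (intro nn_integral_eq_integral) auto
      also have "\<dots> = 1" using that mp by simp
      finally have "prob_space (density M (\<lambda>x. ennreal (w x / m)))"
        by (intro prob_spaceI) simp
      then interpret P: prob_space "density M (\<lambda>x. ennreal (w x / m))" .
      show rd: "real_distribution (L M)"
        unfolding L_def by (rule P.real_distribution_distr) simp
      interpret L: real_distribution "L M" by fact
      have wm: "(\<lambda>x. w x / m) \<in> borel_measurable M" "AE x in M. 0 \<le> w x / m"
        using w0 mp by auto
      show "char (L M) t = (CLINT x|M. w x * iexp (t * X x)) / m"
      proof -
        have "char (L M) t = (CLINT x|density M (\<lambda>x. ennreal (w x / m)). iexp (t * X x))"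
          unfolding char_def L_def by (subst integral_distr) auto
        also have "\<dots> = (CLINT x|M. (w x / m) *\<^sub>R iexp (t * X x))"
          by (rule integral_density) (use wm in auto)
        also have "\<dots> = (CLINT x|M. (w x * iexp (t * X x)) / m)"
          by (simp add: scaleR_conv_of_real field_simps)
        finally show ?thesis by simp
      qed
      have "measure (L M) A = (LINT x|L M. indicator A x)"
        by (simp add: L_def)
      also have "\<dots> = (LINT x|density M (\<lambda>x. ennreal (w x / m)). indicator A (X x))"
        unfolding L_def by (subst integral_distr) auto
      also have "\<dots> = (LINT x|M. (w x / m) *\<^sub>R indicator A (X x))"
        by (rule integral_density) (use wm in auto)
      also have "\<dots> = (LINT x|M. (w x * indicator A (X x)) / m)"
        by (simp add: field_simps)
      finally show "measure (L M) A = (LINT x|M. w x * indicator A (X x)) / m" by simp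
    qed
    note 1 = *[OF fin(1) w X int(1) m_def[symmetric]] and 2 = *[OF fin(2) w' X' int(2) m[symmetric]]
    have "L \<mu> = L \<nu>"
      by (rule Levy_uniqueness[OF 1(1) 2(1)]) (intro ext, simp only: 1(2) 2(2) eq)
    with 1(3) 2(3) show ?thesis using False by simp
  qed
qed

lemma integrable_real_times_iexp:
  fixes M :: "'a::euclidean_space measure" and W :: "'a \<Rightarrow> real"
  assumes "finite_measure M" "sets M = sets borel"
    and "W \<in> borel_measurable borel" "\<And>x. \<bar>W x\<bar> \<le> 1"
  shows "integrable M (\<lambda>x. W x * iexp (b \<bullet> x))"
proof -
  interpret finite_measure M by fact
  have [measurable_cong]: "sets M = sets borel" by fact
  note [measurable] = assms(3)
  show ?thesis
    by (rule integrable_const_bound[where B = 1]) (auto simp: norm_mult assms(4))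
qed

text \<open>Coordinates are handled one at a time. The one-dimensional uniqueness theorem is applied to positive
  weights only, so \<open>cos\<close> and \<open>sin\<close> of the remaining phase are shifted by \<open>1\<close>.\<close>

theorem char_uniqueness_euclidean:
  fixes \<mu> \<nu> :: "'a::euclidean_space measure"
  assumes P: "prob_space \<mu>" "prob_space \<nu>" and S: "sets \<mu> = sets borel" "sets \<nu> = sets borel"
    and char: "\<And>a. (CLINT x|\<mu>. iexp (a \<bullet> x)) = (CLINT x|\<nu>. iexp (a \<bullet> x))"
  shows "\<mu> = \<nu>"
proof -
  interpret \<mu>: prob_space \<mu> by fact
  interpret \<nu>: prob_space \<nu> by fact
  have F: "finite_measure \<mu>" "finite_measure \<nu>"
    by unfold_locales
  note [measurable_cong] = S
  define W :: "('a \<Rightarrow> real set) \<Rightarrow> 'a set \<Rightarrow> 'a \<Rightarrow> real"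
    where "W A J x = (\<Prod>j\<in>J. indicator (A j) (x \<bullet> j))" for A J x
  have W01: "0 \<le> W A J x" "W A J x \<le> 1" for A J x
    unfolding W_def by (auto intro!: prod_nonneg prod_le_1)
  \<comment> \<open>Induction on the set of coordinates already restricted to a Borel set. The empty
    set is the hypothesis \<open>char\<close>; the full basis with b = 0 yields boxes. The phase
    \<open>b\<close> stays arbitrary because treating coordinate \<open>k\<close> adds multiples of
    \<open>k\<close> to it.\<close>
  have rect: "(CLINT x|\<mu>. W A J x * iexp (b \<bullet> x)) = (CLINT x|\<nu>. W A J x * iexp (b \<bullet> x))"
    if A: "\<And>j. A j \<in> sets borel" and "finite J" for A J b
    using \<open>finite J\<close>
  proof (induction J arbitrary: b)
    case empty
    then show ?case by (simp add: W_def char)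
  next
    case (insert k J)
    note [measurable] = A
    have WJ [measurable]: "W A J \<in> borel_measurable borel"
      unfolding W_def by measurable
    note I = integrable_real_times_iexp[OF F(1) S(1) WJ] integrable_real_times_iexp[OF F(2) S(2) WJ]
    have I: "integrable \<mu> (\<lambda>x. W A J x * iexp (b \<bullet> x))" "integrable \<nu> (\<lambda>x. W A J x * iexp (b \<bullet> x))" for b
      using I W01 by auto
    have E: "iexp (t * (x \<bullet> k)) * iexp (b \<bullet> x) = iexp ((t *\<^sub>R k + b) \<bullet> x)" for t b x
      unfolding exp_add[symmetric] by (simp add: inner_add_left inner_commute[of k] algebra_simps)
    \<comment> \<open>By Euler's formula the transform of the shifted weight involves only the
      phases t k, t k + b and t k - b, all covered by the induction hypothesis.\<close>
    have wc: "complex_of_real (W A J x * (1 + cos (b \<bullet> x))) * iexp (t * (x \<bullet> k))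
        = W A J x * iexp ((t *\<^sub>R k + 0) \<bullet> x) + (1/2) * (W A J x * iexp ((t *\<^sub>R k + b) \<bullet> x))
          + (1/2) * (W A J x * iexp ((t *\<^sub>R k + (- b)) \<bullet> x))" for t x
    proof -
      have "complex_of_real (cos (b \<bullet> x)) = (iexp (b \<bullet> x) + iexp ((- b) \<bullet> x)) / 2"
        using cos_exp_eq[of "complex_of_real (b \<bullet> x)"] by (simp add: cos_of_real)
      then show ?thesis
        unfolding E[symmetric] of_real_mult of_real_add of_real_1
        by (simp only:) (simp add: algebra_simps add_divide_distrib)
    qed
    have ws: "complex_of_real (W A J x * (1 + sin (b \<bullet> x))) * iexp (t * (x \<bullet> k))
        = W A J x * iexp ((t *\<^sub>R k + 0) \<bullet> x) + (1/(2*\<i>)) * (W A J x * iexp ((t *\<^sub>R k + b) \<bullet> x))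
          - (1/(2*\<i>)) * (W A J x * iexp ((t *\<^sub>R k + (- b)) \<bullet> x))" for t x
    proof -
      have "complex_of_real (sin (b \<bullet> x)) = (iexp (b \<bullet> x) - iexp ((- b) \<bullet> x)) / (2 * \<i>)"
        using sin_exp_eq[of "complex_of_real (b \<bullet> x)"] by (simp add: sin_of_real)
      then show ?thesis
        unfolding E[symmetric] of_real_mult of_real_add of_real_1
        by (simp only:) (simp add: algebra_simps diff_divide_distrib)
    qed
    have B2: "0 \<le> W A J x * (1 + y)" "W A J x * (1 + y) \<le> 2" if "- 1 \<le> y" "y \<le> 1" for x y
      using mult_mono[of "W A J x" 1 "1 + y" 2] that W01[of A J x] by auto
    \<comment> \<open>The weight without the trigonometric factor, needed to subtract the added 1
      from \<open>c\<close> and \<open>s\<close> again.\<close>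
    have 0: "(LINT x|\<mu>. W A J x * indicator (A k) (x \<bullet> k)) = (LINT x|\<nu>. W A J x * indicator (A k) (x \<bullet> k))"
    proof (rule weighted_char_uniqueness[OF F, where B = 1])
      show "(CLINT x|\<mu>. W A J x * iexp (t * (x \<bullet> k))) = (CLINT x|\<nu>. W A J x * iexp (t * (x \<bullet> k)))" for t
        using insert.IH[of "t *\<^sub>R k"] by (simp add: inner_commute[of k])
    qed (use W01 S in auto)
    have c: "(LINT x|\<mu>. W A J x * (1 + cos (b \<bullet> x)) * indicator (A k) (x \<bullet> k))
      = (LINT x|\<nu>. W A J x * (1 + cos (b \<bullet> x)) * indicator (A k) (x \<bullet> k))"
    proof (rule weighted_char_uniqueness[OF F, where B = 2])
      show "(CLINT x|\<mu>. complex_of_real (W A J x * (1 + cos (b \<bullet> x))) * iexp (t * (x \<bullet> k)))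
        = (CLINT x|\<nu>. complex_of_real (W A J x * (1 + cos (b \<bullet> x))) * iexp (t * (x \<bullet> k)))" for t
        unfolding wc by (simp only: Bochner_Integration.integral_add Bochner_Integration.integrable_add
             integrable_mult_right I integral_mult_right_zero insert.IH)
    qed (use S in \<open>auto intro!: B2\<close>)
    have s: "(LINT x|\<mu>. W A J x * (1 + sin (b \<bullet> x)) * indicator (A k) (x \<bullet> k))
      = (LINT x|\<nu>. W A J x * (1 + sin (b \<bullet> x)) * indicator (A k) (x \<bullet> k))"
    proof (rule weighted_char_uniqueness[OF F, where B = 2])
      show "(CLINT x|\<mu>. complex_of_real (W A J x * (1 + sin (b \<bullet> x))) * iexp (t * (x \<bullet> k)))
        = (CLINT x|\<nu>. complex_of_real (W A J x * (1 + sin (b \<bullet> x))) * iexp (t * (x \<bullet> k)))" for t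
        unfolding ws by (simp only: Bochner_Integration.integral_add Bochner_Integration.integral_diff
             Bochner_Integration.integrable_add
             integrable_mult_right I integral_mult_right_zero insert.IH)
    qed (use S in \<open>auto intro!: B2\<close>)
    have bd: "\<bar>W A J x * indicator (A k) (x \<bullet> k) * y\<bar> \<le> 1" if "\<bar>y\<bar> \<le> 1" for x y
      using W01[of A J x] that by (auto simp: indicator_def abs_mult intro!: mult_le_one)
    have V: "(LINT x|M. W A J x * (1 + g x) * indicator (A k) (x \<bullet> k))
        = (LINT x|M. W A J x * indicator (A k) (x \<bullet> k)) + (LINT x|M. W A J x * indicator (A k) (x \<bullet> k) * g x)"
      "integrable M (\<lambda>x. W A J x * indicator (A k) (x \<bullet> k) * g x)"
      if "finite_measure M" "sets M = sets borel" "g \<in> borel_measurable borel" "\<And>x. \<bar>g x\<bar> \<le> 1" for M g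
    proof -
      interpret finite_measure M by fact
      note [measurable_cong] = that(2)
      note [measurable] = that(3)
      show i: "integrable M (\<lambda>x. W A J x * indicator (A k) (x \<bullet> k) * g x)"
        by (rule integrable_const_bound[where B = 1]) (auto intro!: bd that)
      have "integrable M (\<lambda>x. W A J x * indicator (A k) (x \<bullet> k))"
        by (rule integrable_const_bound[where B = 1]) (use bd[of 1] in auto)
      from Bochner_Integration.integral_add[OF this i]
      show "(LINT x|M. W A J x * (1 + g x) * indicator (A k) (x \<bullet> k))
        = (LINT x|M. W A J x * indicator (A k) (x \<bullet> k)) + (LINT x|M. W A J x * indicator (A k) (x \<bullet> k) * g x)"
        by (simp add: algebra_simps)
    qed
    have split: "(CLINT x|M. W A (insert k J) x * iexp (b \<bullet> x))
       = of_real (LINT x|M. W A J x * indicator (A k) (x \<bullet> k) * cos (b \<bullet> x))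
        + \<i> * of_real (LINT x|M. W A J x * indicator (A k) (x \<bullet> k) * sin (b \<bullet> x))"
      if "finite_measure M" "sets M = sets borel" for M
    proof -
      have "W A (insert k J) x = W A J x * indicator (A k) (x \<bullet> k)" for x
        unfolding W_def using insert by simp
      then have "W A (insert k J) x * iexp (b \<bullet> x) =
          of_real (W A J x * indicator (A k) (x \<bullet> k) * cos (b \<bullet> x)) +
          \<i> * of_real (W A J x * indicator (A k) (x \<bullet> k) * sin (b \<bullet> x))" for x
        by (simp add: exp_Euler cos_of_real sin_of_real algebra_simps)
      then show ?thesis
        using V(2)[OF that, of "\<lambda>x. cos (b \<bullet> x)"] V(2)[OF that, of "\<lambda>x. sin (b \<bullet> x)"]
        by (simp del: of_real_mult)
    qed
    have "(LINT x|\<mu>. W A J x * indicator (A k) (x \<bullet> k) * cos (b \<bullet> x))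
       = (LINT x|\<nu>. W A J x * indicator (A k) (x \<bullet> k) * cos (b \<bullet> x))"
      using V(1)[OF F(1) S(1), of "\<lambda>x. cos (b \<bullet> x)"] V(1)[OF F(2) S(2), of "\<lambda>x. cos (b \<bullet> x)"] 0 c by simp
    moreover have "(LINT x|\<mu>. W A J x * indicator (A k) (x \<bullet> k) * sin (b \<bullet> x))
       = (LINT x|\<nu>. W A J x * indicator (A k) (x \<bullet> k) * sin (b \<bullet> x))"
      using V(1)[OF F(1) S(1), of "\<lambda>x. sin (b \<bullet> x)"] V(1)[OF F(2) S(2), of "\<lambda>x. sin (b \<bullet> x)"] 0 s by simp
    ultimately show ?case
      unfolding split[OF F(1) S(1)] split[OF F(2) S(2)] by simp
  qed
  show ?thesis
  proof (rule measure_eqI_generator_eq_countable[where \<Omega> = UNIV and E = "range (\<lambda>(a, b). box a b)"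
          and A = "range (\<lambda>n::nat. box (- real n *\<^sub>R One) (real n *\<^sub>R One))"])
    show "Int_stable (range (\<lambda>(a, b). box a b :: 'a set))"
      by (auto simp: Int_stable_def box_Int_box)
    show "sets \<mu> = sigma_sets UNIV (range (\<lambda>(a, b). box a b))"
      "sets \<nu> = sigma_sets UNIV (range (\<lambda>(a, b). box a b))"
      unfolding S borel_eq_box by (auto simp: case_prod_unfold)
    show "\<Union> (range (\<lambda>n::nat. box (- real n *\<^sub>R One) (real n *\<^sub>R One))) = (UNIV :: 'a set)"
      using UN_box_eq_UNIV by auto
    fix X :: "'a set" assume "X \<in> range (\<lambda>(a, b). box a b)"
    then obtain a b where X: "X = box a b" by auto
    define A where "A j = {a \<bullet> j <..< b \<bullet> j}" for j
    have "W A Basis x = indicator X x" for x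
      unfolding W_def X box_def A_def by (auto simp: indicator_def intro!: prod.neutral)
    then have "of_real (measure \<mu> X) = (CLINT x|\<mu>. W A Basis x * iexp (0 \<bullet> x))"
      "of_real (measure \<nu> X) = (CLINT x|\<nu>. W A Basis x * iexp (0 \<bullet> x))"
      by (simp_all add: X S)
    with rect[of A Basis 0] have "complex_of_real (measure \<mu> X) = of_real (measure \<nu> X)"
      by (simp add: A_def)
    then have "measure \<mu> X = measure \<nu> X"
      by (simp only: of_real_eq_iff)
    then show "emeasure \<mu> X = emeasure \<nu> X"
      by (simp add: \<mu>.emeasure_eq_measure \<nu>.emeasure_eq_measure)
  qed (auto simp: \<mu>.emeasure_eq_measure)
qed

section \<open>Densities from a two-sided Stein inequality\<close>

text \<open>Since \<open>x (\<phi> x - \<phi> 0)\<close> is the integral of \<open>\<bar>x\<bar> \<phi>' s\<close> over the \<open>s\<close> between \<open>0\<close> and \<open>x\<close>,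
  Fubini turns \<open>E X \<phi>(X)\<close> for centred \<open>X\<close> into the integral of \<open>\<phi>'\<close> against the following weight.\<close>

definition stein_weight :: "real measure \<Rightarrow> real \<Rightarrow> ennreal" where
  "stein_weight \<mu> s = (\<integral>\<^sup>+ x. ennreal \<bar>x\<bar> * indicator ({0<..<x} \<union> {x<..<0}) s \<partial>\<mu>)"

lemma measurable_stein_weight_integrand [measurable]:
  "(\<lambda>(x, s). ennreal \<bar>x\<bar> * indicator ({0<..<x} \<union> {x<..<0}) s :: ennreal) \<in> borel_measurable (borel \<Otimes>\<^sub>M borel)"
  "(\<lambda>(s, x). ennreal \<bar>x\<bar> * indicator ({0<..<x} \<union> {x<..<0}) s :: ennreal) \<in> borel_measurable (borel \<Otimes>\<^sub>M borel)"
proof -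
  have *: "indicator ({0<..<x} \<union> {x<..<0}) s = (if 0 < s \<and> s < x \<or> x < s \<and> s < 0 then 1 else 0 :: ennreal)" for x s :: real
    by (auto simp: indicator_def)
  show "(\<lambda>(x, s). ennreal \<bar>x\<bar> * indicator ({0<..<x} \<union> {x<..<0}) s :: ennreal) \<in> borel_measurable (borel \<Otimes>\<^sub>M borel)"
    "(\<lambda>(s, x). ennreal \<bar>x\<bar> * indicator ({0<..<x} \<union> {x<..<0}) s :: ennreal) \<in> borel_measurable (borel \<Otimes>\<^sub>M borel)"
    unfolding * by measurable
qed

text \<open>Testing on the set where \<open>f\<close> exceeds \<open>g\<close> gives a contradiction
  unless that set is null. Finiteness of the integral of \<open>g\<close> is what makes the opposite
  inequality strict.\<close>

lemma AE_le_if_density_le: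
  assumes [measurable]: "f \<in> borel_measurable M" "g \<in> borel_measurable M"
    and fin: "(\<integral>\<^sup>+ x. g x \<partial>M) \<noteq> \<infinity>"
    and le: "\<And>A. A \<in> sets M \<Longrightarrow> (\<integral>\<^sup>+ x. f x * indicator A x \<partial>M) \<le> (\<integral>\<^sup>+ x. g x * indicator A x \<partial>M)"
  shows "AE x in M. f x \<le> g x"
proof -
  define A where "A = {x \<in> space M. g x < f x}"
  have A [measurable]: "A \<in> sets M" unfolding A_def by measurable
  have "AE x in M. f x * indicator A x \<le> g x * indicator A x"
  proof (rule ccontr)
    assume *: "\<not> (AE x in M. f x * indicator A x \<le> g x * indicator A x)"
    have "(\<integral>\<^sup>+ x. g x * indicator A x \<partial>M) < (\<integral>\<^sup>+ x. f x * indicator A x \<partial>M)"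
    proof (rule nn_integral_less)
      have "(\<integral>\<^sup>+ x. g x * indicator A x \<partial>M) \<le> (\<integral>\<^sup>+ x. g x \<partial>M)"
        by (intro nn_integral_mono) (auto simp: indicator_def)
      then show "(\<integral>\<^sup>+ x. g x * indicator A x \<partial>M) \<noteq> \<infinity>"
        using fin by (auto simp: top_unique)
      show "AE x in M. g x * indicator A x \<le> f x * indicator A x"
        by (auto simp: A_def indicator_def)
    qed (use * in measurable)
    with le[OF A] show False by simp
  qed
  then show ?thesis
    by (rule AE_mp) (auto simp: A_def indicator_def not_less split: if_splits)
qed

text \<open>Derivatives with values in [0, 1] make \<phi> Lipschitz, so x \<phi>(x) is dominated by
  a quadratic and the second moment suffices for integrability. Unbounded test functions are
  recovered later by measure theory.\<close>

locale stein_bounds = real_distribution \<mu> for \<mu> :: "real measure" +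
  fixes c C :: real
  assumes c_pos: "0 < c" and C_pos: "0 < C"
    and square_integrable: "integrable \<mu> (\<lambda>x. x\<^sup>2)"
    and mean_zero: "(LINT x|\<mu>. x) = 0"
    and stein_le: "\<lbrakk>\<And>x. isCont \<psi> x; \<And>x. 0 \<le> \<psi> x; \<And>x. \<psi> x \<le> 1; \<And>x. (\<phi> has_real_derivative \<psi> x) (at x)\<rbrakk>
        \<Longrightarrow> (LINT x|\<mu>. x * \<phi> x) \<le> C * (LINT x|\<mu>. \<psi> x)"
    and stein_ge: "\<lbrakk>\<And>x. isCont \<psi> x; \<And>x. 0 \<le> \<psi> x; \<And>x. \<psi> x \<le> 1; \<And>x. (\<phi> has_real_derivative \<psi> x) (at x)\<rbrakk>
        \<Longrightarrow> c * (LINT x|\<mu>. \<psi> x) \<le> (LINT x|\<mu>. x * \<phi> x)"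
begin

section \<open>Comparison of a centred law with its Stein weight\<close>

lemma integrable_id [simp]: "integrable \<mu> (\<lambda>x. x)"
  using square_integrable by (rule square_integrable_imp_integrable[rotated]) simp

lemma measurable_stein_weight [measurable]: "stein_weight \<mu> \<in> borel_measurable borel"
  unfolding stein_weight_def by measurable

lemma stein_weight_Fubini:
  assumes [measurable]: "g \<in> borel_measurable borel"
  shows "(\<integral>\<^sup>+ s. g s * stein_weight \<mu> s \<partial>lborel) =
    (\<integral>\<^sup>+ x. ennreal \<bar>x\<bar> * (\<integral>\<^sup>+ s. g s * indicator ({0<..<x} \<union> {x<..<0}) s \<partial>lborel) \<partial>\<mu>)"
proof -
  interpret pair_sigma_finite \<mu> lborel ..
  have *: "(\<lambda>(x, s). g s * (ennreal \<bar>x\<bar> * indicator ({0<..<x} \<union> {x<..<0}) s)) \<in> borel_measurable (\<mu> \<Otimes>\<^sub>M lborel)"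
    using measurable_stein_weight_integrand(1) by (simp add: case_prod_unfold)
  have "(\<integral>\<^sup>+ s. g s * stein_weight \<mu> s \<partial>lborel) =
    (\<integral>\<^sup>+ s. (\<integral>\<^sup>+ x. g s * (ennreal \<bar>x\<bar> * indicator ({0<..<x} \<union> {x<..<0}) s) \<partial>\<mu>) \<partial>lborel)"
    unfolding stein_weight_def
    by (intro nn_integral_cong nn_integral_cmult[symmetric]) measurable
  also have "\<dots> = (\<integral>\<^sup>+ x. (\<integral>\<^sup>+ s. g s * (ennreal \<bar>x\<bar> * indicator ({0<..<x} \<union> {x<..<0}) s) \<partial>lborel) \<partial>\<mu>)"
    by (rule Fubini'[OF *])
  also have "\<dots> = (\<integral>\<^sup>+ x. (\<integral>\<^sup>+ s. ennreal \<bar>x\<bar> * (g s * indicator ({0<..<x} \<union> {x<..<0}) s) \<partial>lborel) \<partial>\<mu>)"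
    by (simp add: mult.left_commute)
  also have "\<dots> = (\<integral>\<^sup>+ x. ennreal \<bar>x\<bar> * (\<integral>\<^sup>+ s. g s * indicator ({0<..<x} \<union> {x<..<0}) s \<partial>lborel) \<partial>\<mu>)"
    by (intro nn_integral_cong nn_integral_cmult) measurable
  finally show ?thesis .
qed

lemma nn_integral_between_0:
  fixes \<psi> \<phi> :: "real \<Rightarrow> real"
  assumes [measurable]: "\<psi> \<in> borel_measurable borel"
    and "\<And>s. s \<in> {0..x} \<union> {x..0} \<Longrightarrow> 0 \<le> \<psi> s"
    and "\<And>s. s \<in> {0..x} \<union> {x..0} \<Longrightarrow> (\<phi> has_real_derivative \<psi> s) (at s)"
  shows "(\<integral>\<^sup>+ s. ennreal (\<psi> s) * indicator ({0<..<x} \<union> {x<..<0}) s \<partial>lborel) = ennreal \<bar>\<phi> x - \<phi> 0\<bar>"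
proof -
  have ae: "AE s in lborel. s \<noteq> 0 \<and> s \<noteq> x"
    using AE_lborel_singleton[of 0] AE_lborel_singleton[of x] by eventually_elim auto
  show ?thesis
  proof (cases "0 \<le> x")
    case True
    have "(\<integral>\<^sup>+ s. ennreal (\<psi> s) * indicator ({0<..<x} \<union> {x<..<0}) s \<partial>lborel)
        = (\<integral>\<^sup>+ s. ennreal (\<psi> s) * indicator {0..x} s \<partial>lborel)"
      using ae True by (intro nn_integral_cong_AE) (auto simp: indicator_def)
    also have "\<dots> = ennreal (\<phi> x - \<phi> 0)"
      using assms(2,3) True by (intro nn_integral_FTC_Icc) auto
    also have "\<phi> 0 \<le> \<phi> x"
      using assms(2,3) True by (intro DERIV_nonneg_imp_nondecreasing[of 0 x \<phi>]) auto
    ultimately show ?thesis by simp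
  next
    case False
    have "(\<integral>\<^sup>+ s. ennreal (\<psi> s) * indicator ({0<..<x} \<union> {x<..<0}) s \<partial>lborel)
        = (\<integral>\<^sup>+ s. ennreal (\<psi> s) * indicator {x..0} s \<partial>lborel)"
      using ae False by (intro nn_integral_cong_AE) (auto simp: indicator_def)
    also have "\<dots> = ennreal (\<phi> 0 - \<phi> x)"
      using assms(2,3) False by (intro nn_integral_FTC_Icc) auto
    also have "\<phi> x \<le> \<phi> 0"
      using assms(2,3) False by (intro DERIV_nonneg_imp_nondecreasing[of x 0 \<phi>]) auto
    ultimately show ?thesis by simp
  qed
qed

text \<open>Take an antiderivative \<phi> of \<psi>. Subtracting \<phi>(0) makes x (\<phi>(x) -
  \<phi>(0)) nonnegative, so the nonnegative integral coming from Fubini is an ordinary expectation;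
  the zero mean then removes the constant again.\<close>

lemma stein_weight_continuous_bounds:
  fixes \<psi> :: "real \<Rightarrow> real"
  assumes cont: "\<And>x. isCont \<psi> x" and \<psi>: "\<And>x. 0 \<le> \<psi> x" "\<And>x. \<psi> x \<le> 1"
  shows "(\<integral>\<^sup>+ s. \<psi> s * stein_weight \<mu> s \<partial>lborel) \<le> ennreal C * (\<integral>\<^sup>+ x. \<psi> x \<partial>\<mu>)"
    and "ennreal c * (\<integral>\<^sup>+ x. \<psi> x \<partial>\<mu>) \<le> (\<integral>\<^sup>+ s. \<psi> s * stein_weight \<mu> s \<partial>lborel)"
proof -
  have [measurable]: "\<psi> \<in> borel_measurable borel"
    by (rule borel_measurable_continuous_onI) (use cont in \<open>auto simp: continuous_on_eq_continuous_at\<close>)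
  obtain \<phi> where \<phi>: "\<And>x. (\<phi> has_real_derivative \<psi> x) (at x)"
    using einterval_antiderivative[of "-\<infinity>" "\<infinity>" \<psi>] cont
    by (auto simp: has_real_derivative_iff_has_vector_derivative)
  then have [measurable]: "\<phi> \<in> borel_measurable borel"
    by (intro borel_measurable_continuous_onI) (auto intro: DERIV_isCont simp: continuous_on_eq_continuous_at)
  have mono: "\<phi> x \<le> \<phi> y" if "x \<le> y" for x y
    using that \<phi> \<psi> by (intro DERIV_nonneg_imp_nondecreasing[of x y \<phi>]) auto
  have lip: "\<bar>\<phi> x - \<phi> 0\<bar> \<le> \<bar>x\<bar>" for x
    using field_differentiable_bound[of UNIV \<phi> \<psi> 1 x 0] \<phi> \<psi> by (simp add: has_field_derivative_at_within)
  have lip': "\<bar>x * (\<phi> x - \<phi> 0)\<bar> \<le> x\<^sup>2" for x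
    using mult_left_mono[OF lip[of x] abs_ge_zero[of x]] by (simp add: abs_mult power2_eq_square)
  have i: "integrable \<mu> (\<lambda>x. x * (\<phi> x - \<phi> 0))"
    by (rule Bochner_Integration.integrable_bound[OF square_integrable]) (auto simp: lip')
  have pw: "\<bar>x\<bar> * \<bar>\<phi> x - \<phi> 0\<bar> = x * (\<phi> x - \<phi> 0)" for x
    using mono[of 0 x] mono[of x 0] by (cases "0 \<le> x") (auto simp: abs_of_nonneg abs_of_nonpos algebra_simps)
  have i2: "integrable \<mu> (\<lambda>x. x * \<phi> x)"
    using Bochner_Integration.integrable_add[OF i integrable_mult_left[OF integrable_id, of "\<phi> 0"]]
    by (simp add: algebra_simps)
  have i3: "integrable \<mu> \<psi>"
    by (rule integrable_const_bound[where B = 1]) (use \<psi> in auto)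
  have "(\<integral>\<^sup>+ s. \<psi> s * stein_weight \<mu> s \<partial>lborel) = (\<integral>\<^sup>+ x. ennreal \<bar>x\<bar> * ennreal \<bar>\<phi> x - \<phi> 0\<bar> \<partial>\<mu>)"
    using \<phi> \<psi> by (subst stein_weight_Fubini) (auto simp: nn_integral_between_0[where \<phi> = \<phi>])
  also have "\<dots> = (\<integral>\<^sup>+ x. ennreal (x * (\<phi> x - \<phi> 0)) \<partial>\<mu>)"
    by (simp add: pw flip: ennreal_mult')
  also have "\<dots> = ennreal (LINT x|\<mu>. x * (\<phi> x - \<phi> 0))"
    using i by (intro nn_integral_eq_integral) (auto simp flip: pw)
  also have "(LINT x|\<mu>. x * (\<phi> x - \<phi> 0)) = (LINT x|\<mu>. x * \<phi> x - x * \<phi> 0)"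
    by (simp add: algebra_simps)
  also have "\<dots> = (LINT x|\<mu>. x * \<phi> x)"
    using i2 by (simp add: mean_zero)
  finally have eq: "(\<integral>\<^sup>+ s. \<psi> s * stein_weight \<mu> s \<partial>lborel) = ennreal (LINT x|\<mu>. x * \<phi> x)" .
  have eq': "(\<integral>\<^sup>+ x. \<psi> x \<partial>\<mu>) = ennreal (LINT x|\<mu>. \<psi> x)"
    using i3 \<psi> by (intro nn_integral_eq_integral) auto
  show "(\<integral>\<^sup>+ s. \<psi> s * stein_weight \<mu> s \<partial>lborel) \<le> ennreal C * (\<integral>\<^sup>+ x. \<psi> x \<partial>\<mu>)"
    unfolding eq eq' using stein_le[OF cont \<psi> \<phi>] C_pos \<psi>
    by (simp flip: ennreal_mult' add: ennreal_leI)
  show "ennreal c * (\<integral>\<^sup>+ x. \<psi> x \<partial>\<mu>) \<le> (\<integral>\<^sup>+ s. \<psi> s * stein_weight \<mu> s \<partial>lborel)"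
    unfolding eq eq' using stein_ge[OF cont \<psi> \<phi>] c_pos \<psi>
    by (simp flip: ennreal_mult' add: ennreal_leI)
qed

text \<open>The test function \<psi> = 1: the total mass of the weight is the second moment of the
  law.\<close>

lemma stein_weight_finite: "(\<integral>\<^sup>+ s. stein_weight \<mu> s \<partial>lborel) < \<infinity>"
proof -
  have "(\<integral>\<^sup>+ s. stein_weight \<mu> s \<partial>lborel) \<le> ennreal C"
    using stein_weight_continuous_bounds(1)[of "\<lambda>_. 1"] emeasure_space_1 by simp
  then show ?thesis by (rule le_less_trans) simp
qed

definition "stein_measure = density lborel (stein_weight \<mu>)"

lemma sets_stein_measure [simp, measurable_cong]: "sets stein_measure = sets borel"
  by (simp add: stein_measure_def)

lemma finite_measure_stein_measure: "finite_measure stein_measure"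
  using stein_weight_finite by (intro finite_measureI) (simp add: stein_measure_def emeasure_density)

lemma compact_bounds:
  fixes K :: "real set"
  assumes "compact K"
  shows "emeasure stein_measure K \<le> ennreal C * emeasure \<mu> K" "ennreal c * emeasure \<mu> K \<le> emeasure stein_measure K"
proof -
  interpret stein_measure: finite_measure stein_measure by (rule finite_measure_stein_measure)
  have "emeasure stein_measure K \<le> ennreal C * emeasure \<mu> K \<and> ennreal c * emeasure \<mu> K \<le> emeasure stein_measure K"
  \<comment> \<open>\<open>infdist x {}\<close> is 0 by convention, so for empty \<open>K\<close>
    the functions below would be constantly 1 instead of tending to the indicator.\<close>
  proof (cases "K = {}")
    case False
    have K [measurable]: "K \<in> sets borel" "closed K" using assms by (auto simp: borel_compact compact_imp_closed)
    \<comment> \<open>Continuous tents with values in [0, 1] that decrease to the indicator of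
      \<open>K\<close>, since a point outside the closed set has positive distance from it.\<close>
    define \<psi> where "\<psi> n x = max 0 (1 - real n * infdist x K)" for n x
    have \<psi>: "isCont (\<psi> n) x" "0 \<le> \<psi> n x" "\<psi> n x \<le> 1" for n x
      unfolding \<psi>_def by (auto intro!: continuous_intros simp: infdist_nonneg)
    have [measurable]: "\<psi> n \<in> borel_measurable borel" for n
      by (rule borel_measurable_continuous_onI) (use \<psi>(1) in \<open>auto simp: continuous_on_eq_continuous_at\<close>)
    have lim: "(\<lambda>n. \<psi> n x) \<longlonglongrightarrow> indicator K x" for x
    proof (cases "x \<in> K")
      case True then show ?thesis by (simp add: \<psi>_def)
    next
      case False
      then have d: "infdist x K > 0"
        using in_closed_iff_infdist_zero[of K x] K \<open>K \<noteq> {}\<close> infdist_nonneg[of x K] by (auto simp: less_le)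
      then obtain m :: nat where m: "1 < real m * infdist x K"
        using reals_Archimedean3 by blast
      have "\<psi> n x = 0" if "n \<ge> m" for n
      proof -
        have "real m * infdist x K \<le> real n * infdist x K"
          using that d by (intro mult_right_mono) auto
        with m show ?thesis by (simp add: \<psi>_def)
      qed
      then have "eventually (\<lambda>n. \<psi> n x = indicator K x) sequentially"
        using False by (auto simp: eventually_sequentially)
      then show ?thesis by (rule tendsto_eventually)
    qed
    have lim: "(\<lambda>n. ennreal (\<psi> n x)) \<longlonglongrightarrow> indicator K x" for x
      using tendsto_ennrealI[OF lim[of x]] by (simp add: ennreal_indicator)
    have 1: "(\<lambda>n. \<integral>\<^sup>+ x. \<psi> n x \<partial>M) \<longlonglongrightarrow> (\<integral>\<^sup>+ x. indicator K x \<partial>M)"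
      if [measurable_cong]: "sets M = sets borel" and fin: "finite_measure M" for M
    proof (rule nn_integral_dominated_convergence[where w = "\<lambda>_. 1"])
      interpret finite_measure M by fact
      show "(\<integral>\<^sup>+ x. 1 \<partial>M) < \<infinity>" by (simp add: less_top[symmetric])
    qed (use \<psi> lim in auto)
    have e: "(\<integral>\<^sup>+ x. \<psi> n x \<partial>stein_measure) = (\<integral>\<^sup>+ s. \<psi> n s * stein_weight \<mu> s \<partial>lborel)" for n
      unfolding stein_measure_def by (subst nn_integral_density) (auto simp: mult.commute)
    note lims = 1[OF sets_stein_measure finite_measure_stein_measure] 1[OF events_eq_borel finite_measure_axioms]
    have C: "(\<lambda>n. ennreal C * (\<integral>\<^sup>+ x. \<psi> n x \<partial>\<mu>)) \<longlonglongrightarrow> ennreal C * (\<integral>\<^sup>+ x. indicator K x \<partial>\<mu>)"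
      and c: "(\<lambda>n. ennreal c * (\<integral>\<^sup>+ x. \<psi> n x \<partial>\<mu>)) \<longlonglongrightarrow> ennreal c * (\<integral>\<^sup>+ x. indicator K x \<partial>\<mu>)"
      by (intro ennreal_tendsto_cmult lims(2); simp)+
    have "(\<integral>\<^sup>+ x. indicator K x \<partial>stein_measure) \<le> ennreal C * (\<integral>\<^sup>+ x. indicator K x \<partial>\<mu>)"
      using stein_weight_continuous_bounds(1)[OF \<psi>]
      by (intro LIMSEQ_le[OF lims(1) C]) (auto simp: e)
    moreover have "ennreal c * (\<integral>\<^sup>+ x. indicator K x \<partial>\<mu>) \<le> (\<integral>\<^sup>+ x. indicator K x \<partial>stein_measure)"
      using stein_weight_continuous_bounds(2)[OF \<psi>]
      by (intro LIMSEQ_le[OF c lims(1)]) (auto simp: e)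
    ultimately show ?thesis by simp
  qed simp
  then show "emeasure stein_measure K \<le> ennreal C * emeasure \<mu> K" "ennreal c * emeasure \<mu> K \<le> emeasure stein_measure K"
    by auto
qed

text \<open>Both measures are finite Borel measures on the line, hence inner regular, and each
  inequality passes to the supremum over compact subsets.\<close>

lemma borel_bounds:
  assumes B: "B \<in> sets borel"
  shows "emeasure stein_measure B \<le> ennreal C * emeasure \<mu> B" "ennreal c * emeasure \<mu> B \<le> emeasure stein_measure B"
proof -
  interpret stein_measure: finite_measure stein_measure by (rule finite_measure_stein_measure)
  have 1: "emeasure \<mu> B = (SUP K\<in>{K. K \<subseteq> B \<and> compact K}. emeasure \<mu> K)"
    and 2: "emeasure stein_measure B = (SUP K\<in>{K. K \<subseteq> B \<and> compact K}. emeasure stein_measure K)"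
    using B by (intro inner_regular; simp add: stein_measure.emeasure_eq_measure[of UNIV] emeasure_eq_measure[of UNIV])+
  show "emeasure stein_measure B \<le> ennreal C * emeasure \<mu> B"
    unfolding 2
  proof (rule SUP_least)
    fix K assume K: "K \<in> {K. K \<subseteq> B \<and> compact K}"
    then have "emeasure stein_measure K \<le> ennreal C * emeasure \<mu> K" using compact_bounds by auto
    also have "\<dots> \<le> ennreal C * emeasure \<mu> B"
      using K B by (intro mult_left_mono emeasure_mono) auto
    finally show "emeasure stein_measure K \<le> ennreal C * emeasure \<mu> B" .
  qed
  show "ennreal c * emeasure \<mu> B \<le> emeasure stein_measure B"
    unfolding 1 SUP_mult_left_ennreal
  proof (rule SUP_least)
    fix K assume K: "K \<in> {K. K \<subseteq> B \<and> compact K}"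
    then have "ennreal c * emeasure \<mu> K \<le> emeasure stein_measure K" using compact_bounds by auto
    also have "\<dots> \<le> emeasure stein_measure B"
      using K B by (intro emeasure_mono) auto
    finally show "ennreal c * emeasure \<mu> K \<le> emeasure stein_measure B" .
  qed
qed

lemma nn_integral_bounds:
  assumes g [measurable]: "g \<in> borel_measurable borel"
  shows "(\<integral>\<^sup>+ s. g s * stein_weight \<mu> s \<partial>lborel) \<le> ennreal C * (\<integral>\<^sup>+ x. g x \<partial>\<mu>)"
    and "ennreal c * (\<integral>\<^sup>+ x. g x \<partial>\<mu>) \<le> (\<integral>\<^sup>+ s. g s * stein_weight \<mu> s \<partial>lborel)"
proof -
  have e: "(\<integral>\<^sup>+ s. g s * stein_weight \<mu> s \<partial>lborel) = (\<integral>\<^sup>+ x. g x \<partial>stein_measure)"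
    unfolding stein_measure_def by (subst nn_integral_density) (auto simp: mult.commute)
  \<comment> \<open>With the constant moved into the measure, the set-wise bounds become an order
    between two measures, under which the integral is monotone.\<close>
  have s: "r * (\<integral>\<^sup>+ x. g x \<partial>\<mu>) = (\<integral>\<^sup>+ x. g x \<partial>scale_measure r \<mu>)" for r
    by (subst nn_integral_scale_measure) auto
  show "(\<integral>\<^sup>+ s. g s * stein_weight \<mu> s \<partial>lborel) \<le> ennreal C * (\<integral>\<^sup>+ x. g x \<partial>\<mu>)"
    unfolding e s by (intro nn_integral_mono_measure) (auto simp: le_measure borel_bounds)
  show "ennreal c * (\<integral>\<^sup>+ x. g x \<partial>\<mu>) \<le> (\<integral>\<^sup>+ s. g s * stein_weight \<mu> s \<partial>lborel)"
    unfolding e s by (intro nn_integral_mono_measure) (auto simp: le_measure borel_bounds)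
qed

text \<open>The lower comparison makes every Lebesgue null set null for the law, so Radon-Nikodym
  applies. Integrating over arbitrary Borel sets then turns both comparisons of measures into
  comparisons of densities.\<close>

lemma density_exists:
  obtains \<rho> :: "real \<Rightarrow> real" where "\<rho> \<in> borel_measurable borel" "\<And>z. 0 \<le> \<rho> z"
    "\<mu> = density lborel (\<lambda>z. ennreal (\<rho> z))"
    "AE z in lborel. ennreal c * \<rho> z \<le> stein_weight \<mu> z"
    "AE z in lborel. stein_weight \<mu> z \<le> ennreal C * \<rho> z"
proof -
  have "absolutely_continuous lborel \<mu>"
    unfolding absolutely_continuous_def
  proof
    fix A :: "real set" assume A: "A \<in> null_sets lborel"
    then have "emeasure stein_measure A = 0"
      unfolding stein_measure_def by (subst emeasure_density) (auto intro: nn_integral_null_set)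
    moreover have "A \<in> sets borel" using A by auto
    ultimately have "ennreal c * emeasure \<mu> A \<le> 0" using borel_bounds(2)[of A] by simp
    then show "A \<in> null_sets \<mu>" using c_pos \<open>A \<in> sets borel\<close> by (auto simp: null_sets_def)
  qed
  then obtain f where f [measurable]: "f \<in> borel_measurable lborel" and \<mu>: "density lborel f = \<mu>"
    using sigma_finite_measure.Radon_Nikodym[OF sigma_finite_lborel, of \<mu>] by auto
  have int: "(\<integral>\<^sup>+ x. g x * f x \<partial>lborel) = (\<integral>\<^sup>+ x. g x \<partial>\<mu>)" if [measurable]: "g \<in> borel_measurable borel" for g
    unfolding \<mu>[symmetric] by (subst nn_integral_density) (auto simp: mult.commute)
  have f1: "(\<integral>\<^sup>+ x. f x \<partial>lborel) = 1" using int[of "\<lambda>_. 1"] emeasure_space_1 by simp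
  have "AE x in lborel. f x \<noteq> \<infinity>"
    by (rule nn_integral_PInf_AE) (auto simp: f1)
  then have fin: "AE x in lborel. ennreal (enn2real (f x)) = f x"
    by eventually_elim (auto simp: less_top)
  show ?thesis
  proof
    show "(\<lambda>x. enn2real (f x)) \<in> borel_measurable borel" by measurable
    show "\<mu> = density lborel (\<lambda>z. ennreal (enn2real (f z)))"
      unfolding \<mu>[symmetric] using fin by (intro density_cong) auto
    have "AE z in lborel. ennreal c * f z \<le> stein_weight \<mu> z"
    proof (rule AE_le_if_density_le)
      fix A :: "real set" assume A [measurable]: "A \<in> sets lborel"
      have "(\<integral>\<^sup>+ x. ennreal c * f x * indicator A x \<partial>lborel) = ennreal c * (\<integral>\<^sup>+ x. indicator A x * f x \<partial>lborel)"
        by (subst nn_integral_cmult[symmetric]) (auto simp: mult_ac)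
      also have "\<dots> = ennreal c * (\<integral>\<^sup>+ x. indicator A x \<partial>\<mu>)" by (subst int) auto
      also have "\<dots> \<le> (\<integral>\<^sup>+ x. indicator A x * stein_weight \<mu> x \<partial>lborel)"
        by (intro nn_integral_bounds(2)) auto
      finally show "(\<integral>\<^sup>+ x. ennreal c * f x * indicator A x \<partial>lborel)
          \<le> (\<integral>\<^sup>+ x. stein_weight \<mu> x * indicator A x \<partial>lborel)" by (simp add: mult.commute)
    qed (use stein_weight_finite in auto)
    then show "AE z in lborel. ennreal c * ennreal (enn2real (f z)) \<le> stein_weight \<mu> z"
      using fin by eventually_elim simp
    have "AE z in lborel. stein_weight \<mu> z \<le> ennreal C * f z"
    proof (rule AE_le_if_density_le)
      fix A :: "real set" assume A [measurable]: "A \<in> sets lborel"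
      have "(\<integral>\<^sup>+ x. stein_weight \<mu> x * indicator A x \<partial>lborel) = (\<integral>\<^sup>+ x. indicator A x * stein_weight \<mu> x \<partial>lborel)"
        by (simp add: mult.commute)
      also have "\<dots> \<le> ennreal C * (\<integral>\<^sup>+ x. indicator A x \<partial>\<mu>)" by (intro nn_integral_bounds(1)) auto
      also have "\<dots> = ennreal C * (\<integral>\<^sup>+ x. indicator A x * f x \<partial>lborel)" by (subst int) auto
      also have "\<dots> = (\<integral>\<^sup>+ x. ennreal C * f x * indicator A x \<partial>lborel)"
        by (subst nn_integral_cmult[symmetric]) (auto simp: mult_ac)
      finally show "(\<integral>\<^sup>+ x. stein_weight \<mu> x * indicator A x \<partial>lborel)
          \<le> (\<integral>\<^sup>+ x. ennreal C * f x * indicator A x \<partial>lborel)" .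
    qed (use f1 in \<open>auto simp: nn_integral_cmult\<close>)
    then show "AE z in lborel. stein_weight \<mu> z \<le> ennreal C * ennreal (enn2real (f z))"
      using fin by eventually_elim simp
  qed simp
qed

section \<open>Gaussian bounds for the Stein weight\<close>

lemma stein_weight_pos:
  assumes "0 < t"
  shows "stein_weight \<mu> t = ennreal (LINT x|\<mu>. x * indicator {t<..} x)"
proof -
  have "stein_weight \<mu> t = (\<integral>\<^sup>+ x. ennreal (x * indicator {t<..} x) \<partial>\<mu>)"
    unfolding stein_weight_def using assms by (intro nn_integral_cong) (auto simp: indicator_def)
  also have "\<dots> = ennreal (LINT x|\<mu>. x * indicator {t<..} x)"
    using assms integrable_real_mult_indicator[of "{t<..}" \<mu> "\<lambda>x. x"]
    by (intro nn_integral_eq_integral) (auto simp: indicator_def)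
  finally show ?thesis .
qed

text \<open>The test function \<open>s exp (s\<^sup>2/2D)\<close>, cut off at \<open>t\<close>, plays the role of an integrating factor:
  it turns the two-sided comparison into Gaussian bounds for the weight without any differentiation.\<close>

lemma integrating_factor:
  assumes t: "0 < t" and D: "0 < D"
  defines "g \<equiv> \<lambda>s. ennreal (s * exp (s\<^sup>2 / (2 * D)) * indicator {0<..t} s)"
  shows "(\<integral>\<^sup>+ x. g x \<partial>\<mu>) = ennreal (LINT x|\<mu>. x * exp (x\<^sup>2 / (2 * D)) * indicator {0<..t} x)"
    and "(\<integral>\<^sup>+ s. g s * stein_weight \<mu> s \<partial>lborel) = ennreal (D * ((LINT x|\<mu>. x * exp (x\<^sup>2 / (2 * D)) * indicator {0<..t} x)
      + exp (t\<^sup>2 / (2 * D)) * (LINT x|\<mu>. x * indicator {t<..} x) - (LINT x|\<mu>. x * indicator {0<..} x)))"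
    and "0 \<le> D * ((LINT x|\<mu>. x * exp (x\<^sup>2 / (2 * D)) * indicator {0<..t} x)
      + exp (t\<^sup>2 / (2 * D)) * (LINT x|\<mu>. x * indicator {t<..} x) - (LINT x|\<mu>. x * indicator {0<..} x))"
proof -
  let ?b = "\<lambda>x. x * exp (x\<^sup>2 / (2 * D)) * indicator {0<..t} x"
  have b: "integrable \<mu> ?b"
  proof (rule integrable_const_bound[where B = "t * exp (t\<^sup>2 / (2 * D))"])
    show "AE x in \<mu>. norm (?b x) \<le> t * exp (t\<^sup>2 / (2 * D))"
      using t D by (auto simp: indicator_def abs_mult intro!: AE_I2 mult_mono divide_right_mono power_mono)
  qed auto
  show "(\<integral>\<^sup>+ x. g x \<partial>\<mu>) = ennreal (LINT x|\<mu>. ?b x)"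
    unfolding g_def by (intro nn_integral_eq_integral b) (auto simp: indicator_def)
  \<comment> \<open>D exp(s^2/2D) is an antiderivative of s exp(s^2/2D); the cut-off stops it at min
    x t, and nothing is collected for x \<le> 0.\<close>
  have inner: "(\<integral>\<^sup>+ s. g s * indicator ({0<..<x} \<union> {x<..<0}) s \<partial>lborel)
      = ennreal (D * exp ((max 0 (min x t))\<^sup>2 / (2 * D)) - D)" for x
  proof (cases "0 < x")
    case True
    define m where "m = min x t"
    have m: "0 \<le> m" using True t by (simp add: m_def)
    have ae: "AE s in lborel. s \<noteq> 0 \<and> s \<noteq> x \<and> s \<noteq> m"
      using AE_lborel_singleton[of 0] AE_lborel_singleton[of x] AE_lborel_singleton[of m] by eventually_elim auto
    have "(\<integral>\<^sup>+ s. g s * indicator ({0<..<x} \<union> {x<..<0}) s \<partial>lborel)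
      = (\<integral>\<^sup>+ s. ennreal (s * exp (s\<^sup>2 / (2 * D))) * indicator {0..m} s \<partial>lborel)"
      using ae True t unfolding g_def by (intro nn_integral_cong_AE) (auto simp: indicator_def m_def)
    also have "\<dots> = ennreal (D * exp (m\<^sup>2 / (2 * D)) - D * exp (0\<^sup>2 / (2 * D)))"
      by (rule nn_integral_FTC_Icc[where F = "\<lambda>s. D * exp (s\<^sup>2 / (2 * D))"])
        (use m D in \<open>auto intro!: derivative_eq_intros simp: field_simps\<close>)
    finally show ?thesis using m by (simp add: m_def)
  next
    case False
    then have "(\<integral>\<^sup>+ s. g s * indicator ({0<..<x} \<union> {x<..<0}) s \<partial>lborel) = (\<integral>\<^sup>+ s. 0 \<partial>(lborel :: real measure))"
      by (intro nn_integral_cong) (auto simp: g_def indicator_def)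
    then show ?thesis using False by simp
  qed
  let ?u = "\<lambda>x. x * indicator {t<..} x" and ?v = "\<lambda>x. x * indicator {0<..} x :: real"
  have uv: "integrable \<mu> ?u" "integrable \<mu> ?v"
    by (intro integrable_real_mult_indicator; simp)+
  let ?a = "\<lambda>x. D * (?b x + exp (t\<^sup>2 / (2 * D)) * ?u x - ?v x)"
  have a: "ennreal \<bar>x\<bar> * ennreal (D * exp ((max 0 (min x t))\<^sup>2 / (2 * D)) - D) = ennreal (?a x)"
    and a0: "0 \<le> ?a x" for x
  proof -
    have nn: "0 \<le> D * exp ((max 0 (min x t))\<^sup>2 / (2 * D)) - D" using D by simp
    \<comment> \<open>The three terms of \<open>?a\<close> separate the ranges of x: the first is
      the part 0 < x \<le> t, the second the part x > t where the exponential is frozen at t, and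
      the third the constant D subtracted for all x > 0.\<close>
    have eq: "\<bar>x\<bar> * (D * exp ((max 0 (min x t))\<^sup>2 / (2 * D)) - D) = ?a x"
      using t by (auto simp: indicator_def min_def max_def algebra_simps)
    show "ennreal \<bar>x\<bar> * ennreal (D * exp ((max 0 (min x t))\<^sup>2 / (2 * D)) - D) = ennreal (?a x)"
      unfolding eq[symmetric] by (rule ennreal_mult[symmetric]) (use nn in auto)
    show "0 \<le> ?a x" unfolding eq[symmetric] using nn by (intro mult_nonneg_nonneg) auto
  qed
  have "(\<integral>\<^sup>+ s. g s * stein_weight \<mu> s \<partial>lborel) = (\<integral>\<^sup>+ x. ennreal (?a x) \<partial>\<mu>)"
    by (subst stein_weight_Fubini) (simp_all only: inner a, simp add: g_def)
  also have "\<dots> = ennreal (LINT x|\<mu>. ?a x)"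
    using b uv a0 by (intro nn_integral_eq_integral) auto
  also have eq: "(LINT x|\<mu>. ?a x) = D * ((LINT x|\<mu>. ?b x) + exp (t\<^sup>2 / (2 * D)) * (LINT x|\<mu>. ?u x) - (LINT x|\<mu>. ?v x))"
    using b uv by simp
  finally show "(\<integral>\<^sup>+ s. g s * stein_weight \<mu> s \<partial>lborel) = ennreal (D * ((LINT x|\<mu>. ?b x)
      + exp (t\<^sup>2 / (2 * D)) * (LINT x|\<mu>. ?u x) - (LINT x|\<mu>. ?v x)))" .
  show "0 \<le> D * ((LINT x|\<mu>. ?b x) + exp (t\<^sup>2 / (2 * D)) * (LINT x|\<mu>. ?u x) - (LINT x|\<mu>. ?v x))"
    unfolding eq[symmetric] using a0 by (intro integral_nonneg_AE) auto
qed

text \<open>Origin of the factor 1/2 in the final bounds: the positive part is (\<bar>x\<bar> + x)/2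
  and the mean vanishes.\<close>

lemma integral_positive_part: "(LINT x|\<mu>. x * indicator {0<..} x) = (LINT x|\<mu>. \<bar>x\<bar>) / 2"
proof -
  have "(LINT x|\<mu>. x * indicator {0<..} x) = (LINT x|\<mu>. (\<bar>x\<bar> + x) / 2)"
    by (intro Bochner_Integration.integral_cong) (auto simp: indicator_def)
  then show ?thesis by (simp add: mean_zero)
qed

text \<open>Choosing the parameter D of the integrating factor equal to the comparison constant
  makes the uncontrolled term \<open>B D\<close> appear on both sides and cancel. What remains
  compares exp(t^2/2D) k with p, the value of E[Z; Z > 0].\<close>

lemma stein_weight_gaussian_bounds_pos:
  assumes t: "0 < t"
  shows "stein_weight \<mu> t \<le> ennreal ((LINT x|\<mu>. \<bar>x\<bar>) / 2 * exp (- t\<^sup>2 / (2 * C)))"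
    and "ennreal ((LINT x|\<mu>. \<bar>x\<bar>) / 2 * exp (- t\<^sup>2 / (2 * c))) \<le> stein_weight \<mu> t"
proof -
  define p where "p = (LINT x|\<mu>. \<bar>x\<bar>) / 2"
  define k where "k = (LINT x|\<mu>. x * indicator {t<..} x)"
  define B where "B D = (LINT x|\<mu>. x * exp (x\<^sup>2 / (2 * D)) * indicator {0<..t} x)" for D :: real
  have B: "0 \<le> B D" for D unfolding B_def by (auto intro!: integral_nonneg_AE simp: indicator_def)
  note fac = integrating_factor[OF t, folded B_def k_def, unfolded integral_positive_part, folded p_def]
  have "ennreal (C * (B C + exp (t\<^sup>2 / (2 * C)) * k - p)) \<le> ennreal C * ennreal (B C)"
    unfolding fac(1)[OF C_pos, symmetric] fac(2)[OF C_pos, symmetric]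
    by (intro nn_integral_bounds) auto
  then have "C * (B C + exp (t\<^sup>2 / (2 * C)) * k - p) \<le> C * B C"
    using B[of C] C_pos by (simp add: ennreal_le_iff flip: ennreal_mult')
  then have "exp (t\<^sup>2 / (2 * C)) * k \<le> p" using C_pos by simp
  then have "k \<le> p * exp (- t\<^sup>2 / (2 * C))" by (simp add: exp_minus field_simps)
  then show "stein_weight \<mu> t \<le> ennreal ((LINT x|\<mu>. \<bar>x\<bar>) / 2 * exp (- t\<^sup>2 / (2 * C)))"
    unfolding stein_weight_pos[OF t] k_def[symmetric] p_def[symmetric] by (rule ennreal_leI)
  have "ennreal c * ennreal (B c) \<le> ennreal (c * (B c + exp (t\<^sup>2 / (2 * c)) * k - p))"
    unfolding fac(1)[OF c_pos, symmetric] fac(2)[OF c_pos, symmetric]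
    by (intro nn_integral_bounds) auto
  \<comment> \<open>An inequality in \<open>ennreal\<close> transfers to the reals only if the
    right-hand side was not truncated at 0, which \<open>fac(3)\<close> guarantees.\<close>
  then have "c * B c \<le> c * (B c + exp (t\<^sup>2 / (2 * c)) * k - p)"
    using fac(3)[OF c_pos] c_pos by (simp add: ennreal_le_iff flip: ennreal_mult')
  then have "p \<le> exp (t\<^sup>2 / (2 * c)) * k" using c_pos by simp
  then have "p * exp (- t\<^sup>2 / (2 * c)) \<le> k" by (simp add: exp_minus field_simps)
  then show "ennreal ((LINT x|\<mu>. \<bar>x\<bar>) / 2 * exp (- t\<^sup>2 / (2 * c))) \<le> stein_weight \<mu> t"
    unfolding stein_weight_pos[OF t] k_def[symmetric] p_def[symmetric] by (rule ennreal_leI)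
qed

text \<open>The class of test functions is stable under reflection: \<phi> becomes -\<phi>(-x), with
  derivative \<psi>(-x). This reduces negative arguments of the weight to positive ones.\<close>

lemma reflected: "stein_bounds (distr \<mu> borel uminus) c C"
proof -
  interpret R: real_distribution "distr \<mu> borel uminus"
    by (rule real_distribution_distr) simp
  have D: "((\<lambda>x. - \<phi> (- x)) has_real_derivative \<psi> (- x)) (at x)"
    if "\<And>x. (\<phi> has_real_derivative \<psi> x) (at x)" for \<phi> \<psi> :: "real \<Rightarrow> real" and x
    by (auto intro!: derivative_eq_intros DERIV_chain2[OF that])
  have m: "\<psi> \<in> borel_measurable borel" if "\<And>x. isCont \<psi> x" for \<psi> :: "real \<Rightarrow> real"
    by (rule borel_measurable_continuous_onI) (use that in \<open>auto simp: continuous_on_eq_continuous_at\<close>)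
  show ?thesis
  proof
    fix \<psi> \<phi> :: "real \<Rightarrow> real"
    assume *: "\<And>x. isCont \<psi> x" "\<And>x. 0 \<le> \<psi> x" "\<And>x. \<psi> x \<le> 1" "\<And>x. (\<phi> has_real_derivative \<psi> x) (at x)"
    have [measurable]: "\<psi> \<in> borel_measurable borel" "\<phi> \<in> borel_measurable borel"
      using *(1) DERIV_isCont[OF *(4)] by (auto intro: m)
    have c: "isCont (\<lambda>x. \<psi> (- x)) x" for x
      by (rule isCont_o2[OF _ *(1)]) auto
    show "(LINT x|distr \<mu> borel uminus. x * \<phi> x) \<le> C * (LINT x|distr \<mu> borel uminus. \<psi> x)"
      using stein_le[OF c *(2,3) D[OF *(4)]] by (simp add: integral_distr)
    show "c * (LINT x|distr \<mu> borel uminus. \<psi> x) \<le> (LINT x|distr \<mu> borel uminus. x * \<phi> x)"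
      using stein_ge[OF c *(2,3) D[OF *(4)]] by (simp add: integral_distr)
  qed (use c_pos C_pos square_integrable mean_zero in \<open>auto simp: integrable_distr_eq integral_distr\<close>)
qed

lemma stein_weight_reflected: "stein_weight (distr \<mu> borel uminus) s = stein_weight \<mu> (- s)"
  unfolding stein_weight_def by (subst nn_integral_distr) (auto intro!: nn_integral_cong simp: indicator_def)

text \<open>The point 0 is left out because the intervals in the weight are open, so the weight is 0
  there whatever the law. A single point does not affect an almost everywhere statement.\<close>

lemma stein_weight_gaussian_bounds:
  assumes t: "t \<noteq> 0"
  shows "stein_weight \<mu> t \<le> ennreal ((LINT x|\<mu>. \<bar>x\<bar>) / 2 * exp (- t\<^sup>2 / (2 * C)))"
    and "ennreal ((LINT x|\<mu>. \<bar>x\<bar>) / 2 * exp (- t\<^sup>2 / (2 * c))) \<le> stein_weight \<mu> t"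
proof -
  interpret R: stein_bounds "distr \<mu> borel uminus" c C by (rule reflected)
  have e: "(LINT x|distr \<mu> borel uminus. \<bar>x\<bar>) = (LINT x|\<mu>. \<bar>x\<bar>)" by (simp add: integral_distr)
  show "stein_weight \<mu> t \<le> ennreal ((LINT x|\<mu>. \<bar>x\<bar>) / 2 * exp (- t\<^sup>2 / (2 * C)))"
    "ennreal ((LINT x|\<mu>. \<bar>x\<bar>) / 2 * exp (- t\<^sup>2 / (2 * c))) \<le> stein_weight \<mu> t"
    using t stein_weight_gaussian_bounds_pos[of t] R.stein_weight_gaussian_bounds_pos[of "- t"]
    by (cases "0 < t"; simp add: stein_weight_reflected e)+
qed

theorem gaussian_density_bounds:
  obtains \<rho> :: "real \<Rightarrow> real" where "\<rho> \<in> borel_measurable borel" "\<And>z. 0 \<le> \<rho> z"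
    "\<mu> = density lborel (\<lambda>z. ennreal (\<rho> z))"
    "AE z in lborel. (LINT x|\<mu>. \<bar>x\<bar>) / (2 * C) * exp (- z\<^sup>2 / (2 * c)) \<le> \<rho> z \<and>
       \<rho> z \<le> (LINT x|\<mu>. \<bar>x\<bar>) / (2 * c) * exp (- z\<^sup>2 / (2 * C))"
proof -
  obtain \<rho> :: "real \<Rightarrow> real" where \<rho>: "\<rho> \<in> borel_measurable borel" "\<And>z. 0 \<le> \<rho> z"
    "\<mu> = density lborel (\<lambda>z. ennreal (\<rho> z))"
    and le: "AE z in lborel. ennreal c * \<rho> z \<le> stein_weight \<mu> z"
    and ge: "AE z in lborel. stein_weight \<mu> z \<le> ennreal C * \<rho> z"
    by (rule density_exists) (rule that)
  have A: "0 \<le> (LINT x|\<mu>. \<bar>x\<bar>)" by simp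
  show ?thesis
  proof (rule that[OF \<rho>])
    show "AE z in lborel. (LINT x|\<mu>. \<bar>x\<bar>) / (2 * C) * exp (- z\<^sup>2 / (2 * c)) \<le> \<rho> z \<and>
       \<rho> z \<le> (LINT x|\<mu>. \<bar>x\<bar>) / (2 * c) * exp (- z\<^sup>2 / (2 * C))"
      using le ge AE_lborel_singleton[of 0]
    proof eventually_elim
      case (elim z)
      have "ennreal (c * \<rho> z) \<le> ennreal ((LINT x|\<mu>. \<bar>x\<bar>) / 2 * exp (- z\<^sup>2 / (2 * C)))"
        using order_trans[OF elim(1) stein_weight_gaussian_bounds(1)[OF elim(3)]] c_pos \<rho>(2)
        by (simp add: ennreal_mult')
      moreover have "ennreal ((LINT x|\<mu>. \<bar>x\<bar>) / 2 * exp (- z\<^sup>2 / (2 * c))) \<le> ennreal (C * \<rho> z)"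
        using order_trans[OF stein_weight_gaussian_bounds(2)[OF elim(3)] elim(2)] C_pos \<rho>(2)
        by (simp add: ennreal_mult')
      ultimately have "c * \<rho> z \<le> (LINT x|\<mu>. \<bar>x\<bar>) / 2 * exp (- z\<^sup>2 / (2 * C))"
        "(LINT x|\<mu>. \<bar>x\<bar>) / 2 * exp (- z\<^sup>2 / (2 * c)) \<le> C * \<rho> z"
        using A C_pos \<rho>(2)[of z] by (simp_all add: ennreal_le_iff)
      then show ?case using c_pos C_pos by (simp add: field_simps)
    qed
  qed
qed

end

section \<open>Centred Gaussian measures\<close>

lemma gradient_lipschitz:
  fixes F :: "'a::real_inner \<Rightarrow> real"
  assumes "\<And>x. (F has_derivative (\<lambda>h. G x \<bullet> h)) (at x)" "\<And>x. norm (G x) \<le> L"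
  shows "\<bar>F x - F y\<bar> \<le> L * norm (x - y)"
proof -
  have "norm (F x - F y) \<le> L * norm (x - y)"
  proof (rule differentiable_bound[of UNIV])
    fix z :: 'a
    show "(F has_derivative (\<lambda>h. G z \<bullet> h)) (at z within UNIV)" using assms(1) by simp
    show "onorm (\<lambda>h. G z \<bullet> h) \<le> L"
    proof (rule onorm_bound)
      fix h show "norm (G z \<bullet> h) \<le> L * norm h"
        using order_trans[OF Cauchy_Schwarz_ineq2 mult_right_mono[OF assms(2) norm_ge_zero]] by simp
    qed (use order_trans[OF norm_ge_zero assms(2)] in auto)
  qed auto
  then show ?thesis by simp
qed

lemma has_real_derivative_along_line:
  fixes F :: "'a::real_inner \<Rightarrow> real"
  assumes "\<And>x. (F has_derivative (\<lambda>h. G x \<bullet> h)) (at x)"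
    and "(\<gamma> has_vector_derivative v) (at s)"
  shows "((\<lambda>s. F (\<gamma> s)) has_real_derivative G (\<gamma> s) \<bullet> v) (at s)"
proof -
  have "((\<lambda>s. F (\<gamma> s)) has_derivative (\<lambda>h. G (\<gamma> s) \<bullet> (h *\<^sub>R v))) (at s)"
    using has_derivative_compose[OF assms(2)[unfolded has_vector_derivative_def] assms(1)] by simp
  then show ?thesis
    by (simp add: has_field_derivative_def mult_commute_abs)
qed

text \<open>The normal density n satisfies \<sigma>^2 n' = -x n, so the difference of the two
  integrands is the derivative of \<sigma>^2 n \<gamma>. This vanishes at both ends because \<gamma>
  grows at most linearly.\<close>

lemma normal_density_integration_by_parts:
  fixes \<gamma> \<gamma>' :: "real \<Rightarrow> real"
  assumes \<sigma>: "0 < \<sigma>" and d: "\<And>x. (\<gamma> has_real_derivative \<gamma>' x) (at x)"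
    and c: "\<And>x. isCont \<gamma>' x" and B: "\<And>x. \<bar>\<gamma>' x\<bar> \<le> L"
  shows "(LBINT x. normal_density 0 \<sigma> x * (x * \<gamma> x)) = \<sigma>\<^sup>2 * (LBINT x. normal_density 0 \<sigma> x * \<gamma>' x)"
proof -
  let ?n = "normal_density 0 \<sigma>"
  have L: "0 \<le> L" using B[of 0] by linarith
  have [measurable]: "\<gamma>' \<in> borel_measurable borel" "\<gamma> \<in> borel_measurable borel"
    using c DERIV_isCont[OF d] by (auto intro!: borel_measurable_continuous_onI simp: continuous_on_eq_continuous_at)
  have lip: "\<bar>\<gamma> x\<bar> \<le> \<bar>\<gamma> 0\<bar> + L * \<bar>x\<bar>" for x
    using field_differentiable_bound[of UNIV \<gamma> \<gamma>' L x 0] d B by (simp add: has_field_derivative_at_within)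
  have i1: "integrable lborel (\<lambda>x. ?n x * \<gamma>' x)"
  proof (rule Bochner_Integration.integrable_bound)
    show "integrable lborel (\<lambda>x. L * ?n x)" using \<sigma> by simp
    show "AE x in lborel. norm (?n x * \<gamma>' x) \<le> norm (L * ?n x)"
      using mult_left_mono[OF B normal_density_nonneg] L by (auto simp: abs_mult mult.commute)
  qed measurable
  have i2: "integrable lborel (\<lambda>x. ?n x * (x * \<gamma> x))"
  proof (rule Bochner_Integration.integrable_bound)
    show "integrable lborel (\<lambda>x. \<bar>\<gamma> 0\<bar> * (?n x * \<bar>x\<bar> ^ 1) + L * (?n x * x ^ 2))"
      using integrable_normal_moment_abs[OF \<sigma>, of 0 1] integrable_normal_moment[OF \<sigma>, of 0 2] by simp
    have "\<bar>?n x * (x * \<gamma> x)\<bar> \<le> \<bar>\<gamma> 0\<bar> * (?n x * \<bar>x\<bar> ^ 1) + L * (?n x * x ^ 2)" for x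
    proof -
      have "\<bar>?n x * (x * \<gamma> x)\<bar> = ?n x * \<bar>x\<bar> * \<bar>\<gamma> x\<bar>" by (simp add: abs_mult)
      also have "\<dots> \<le> ?n x * \<bar>x\<bar> * (\<bar>\<gamma> 0\<bar> + L * \<bar>x\<bar>)" by (intro mult_left_mono lip) auto
      also have "\<dots> = \<bar>\<gamma> 0\<bar> * (?n x * \<bar>x\<bar> ^ 1) + L * (?n x * \<bar>x\<bar> ^ 2)"
        by (simp add: algebra_simps power2_eq_square)
      finally show ?thesis by simp
    qed
    then show "AE x in lborel. norm (?n x * (x * \<gamma> x)) \<le> norm (\<bar>\<gamma> 0\<bar> * (?n x * \<bar>x\<bar> ^ 1) + L * (?n x * x ^ 2))"
      by (auto intro!: AE_I2 order_trans[OF _ abs_ge_self])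
  qed measurable
  let ?f = "\<lambda>x. \<sigma>\<^sup>2 * (?n x * \<gamma>' x) - ?n x * (x * \<gamma> x)"
  have n: "?n x = exp (- x\<^sup>2 / (2 * \<sigma>\<^sup>2)) / sqrt (2 * pi * \<sigma>\<^sup>2)" for x
    by (simp add: normal_density_def)
  have n': "(?n has_real_derivative - x / \<sigma>\<^sup>2 * ?n x) (at x)" for x
    unfolding normal_density_def using \<sigma>
    by (auto intro!: derivative_eq_intros simp: field_simps power2_eq_square)
  have F: "((\<lambda>x. \<sigma>\<^sup>2 * (?n x * \<gamma> x)) has_vector_derivative ?f x) (at x)" for x
  proof -
    have "((\<lambda>x. \<sigma>\<^sup>2 * (?n x * \<gamma> x)) has_real_derivative ?f x) (at x)"
      using \<sigma> by (auto intro!: derivative_eq_intros n' d simp: field_simps)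
    then show ?thesis by (simp add: has_real_derivative_iff_has_vector_derivative)
  qed
  have bd: "norm (\<sigma>\<^sup>2 * (?n x * \<gamma> x)) \<le> \<sigma>\<^sup>2 * (exp (- x\<^sup>2 / (2 * \<sigma>\<^sup>2)) / sqrt (2 * pi * \<sigma>\<^sup>2) * (\<bar>\<gamma> 0\<bar> + L * \<bar>x\<bar>))" for x
    unfolding n[symmetric] by (auto simp: abs_mult intro!: mult_left_mono lip)
  have lim1: "((\<lambda>x. \<sigma>\<^sup>2 * (exp (- x\<^sup>2 / (2 * \<sigma>\<^sup>2)) / sqrt (2 * pi * \<sigma>\<^sup>2) * (\<bar>\<gamma> 0\<bar> + L * \<bar>x\<bar>))) \<longlongrightarrow> 0) at_top"
    using \<sigma> by real_asymp
  have lim2: "((\<lambda>x. \<sigma>\<^sup>2 * (exp (- x\<^sup>2 / (2 * \<sigma>\<^sup>2)) / sqrt (2 * pi * \<sigma>\<^sup>2) * (\<bar>\<gamma> 0\<bar> + L * \<bar>x\<bar>))) \<longlongrightarrow> 0) at_bot"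
    using \<sigma> by real_asymp
  have l: "((\<lambda>x. \<sigma>\<^sup>2 * (?n x * \<gamma> x)) \<longlongrightarrow> 0) at_top" "((\<lambda>x. \<sigma>\<^sup>2 * (?n x * \<gamma> x)) \<longlongrightarrow> 0) at_bot"
    by (rule Lim_null_comparison[OF always_eventually[OF allI[OF bd]]], rule lim1 lim2)+
  have "(LBINT x=-\<infinity>..\<infinity>. ?f x) = 0 - 0"
  proof (rule interval_integral_FTC_integrable)
    show "isCont ?f x" for x
      using c[of x] DERIV_isCont[OF d[of x]] DERIV_isCont[OF n'[of x]] by (intro continuous_intros) auto
    show "set_integrable lborel (einterval (- \<infinity>) \<infinity>) ?f"
      using i1 i2 by (simp add: set_integrable_def)
    show "(((\<lambda>x. \<sigma>\<^sup>2 * (?n x * \<gamma> x)) \<circ> real_of_ereal) \<longlongrightarrow> 0) (at_right (- \<infinity>))"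
      "(((\<lambda>x. \<sigma>\<^sup>2 * (?n x * \<gamma> x)) \<circ> real_of_ereal) \<longlongrightarrow> 0) (at_left \<infinity>)"
      using l by (simp_all add: ereal_tendsto_simps)
  qed (use F in auto)
  then have "(LBINT x. ?f x) = 0"
    by (simp add: interval_lebesgue_integral_def set_lebesgue_integral_def)
  then show ?thesis using i1 i2 by simp
qed

lemma gaussian_var_cases:
  assumes "prob_space M" "gaussian_var M X"
  obtains (degenerate) m where "AE x in M. X x = m"
  | (normal) m \<sigma> where "0 < \<sigma>" "distributed M lborel X (\<lambda>x. ennreal (normal_density m \<sigma> x))"
proof -
  interpret prob_space M by fact
  have [measurable]: "X \<in> borel_measurable M" using assms(2) by (simp add: gaussian_var_def)
  from assms(2) consider m where "distr M borel X = return borel m"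
    | m \<sigma> where "0 < \<sigma>" "distributed M lborel X (\<lambda>x. ennreal (normal_density m \<sigma> x))"
    unfolding gaussian_var_def by blast
  then show ?thesis
  proof cases
    case 1
    have "AE y in distr M borel X. y = m"
      unfolding 1 by (subst AE_return) auto
    then have "AE x in M. X x = m"
      by (subst (asm) AE_distr_iff) auto
    then show ?thesis by (rule degenerate)
  qed (rule normal)
qed

text \<open>The covariance may be singular, so no Lebesgue density is available on the space. All
  information comes from the one-dimensional marginals, each normal or a Dirac law.\<close>

locale centered_gaussian = prob_space \<mu> for \<mu> :: "'a::euclidean_space measure" +
  assumes sets_borel [simp, measurable_cong]: "sets \<mu> = sets borel"
    and gaussian: "gaussian_var \<mu> (\<lambda>x. a \<bullet> x)"
    and mean_zero: "(LINT x|\<mu>. a \<bullet> x) = 0"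
begin

lemma space_UNIV [simp]: "space \<mu> = UNIV"
  using sets_eq_imp_space_eq[OF sets_borel] by simp

definition cov :: "'a \<Rightarrow> 'a \<Rightarrow> real" where
  "cov a b = (LINT x|\<mu>. (a \<bullet> x) * (b \<bullet> x))"

lemma marginal_cases:
  obtains (degenerate) "AE x in \<mu>. a \<bullet> x = 0"
  | (normal) \<sigma> where "0 < \<sigma>" "distributed \<mu> lborel (\<lambda>x. a \<bullet> x) (\<lambda>x. ennreal (normal_density 0 \<sigma> x))"
  using prob_space_axioms gaussian[of a]
proof (cases rule: gaussian_var_cases)
  case (degenerate m)
  then have "(LINT x|\<mu>. a \<bullet> x) = (LINT x|\<mu>. m)"
    by (intro integral_cong_AE) auto
  then have "m = 0" using mean_zero[of a] prob_space by simp
  with degenerate show ?thesis by (intro that(1)) auto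
next
  case (normal m \<sigma>)
  then have "m = 0"
    using normal_distributed_expectation[OF normal] mean_zero by simp
  with normal show ?thesis by (intro that(2)) auto
qed

lemma integrable_square: "integrable \<mu> (\<lambda>x. (a \<bullet> x)\<^sup>2)"
proof (cases rule: marginal_cases[of a])
  case degenerate
  then show ?thesis by (subst integrable_cong_AE[where g = "\<lambda>_. 0"]) auto
next
  case (normal \<sigma>)
  then show ?thesis
    using integrable_normal_moment[of \<sigma> 0 2] by (subst distributed_integrable[OF normal(2), symmetric]) auto
qed

lemma normal_cov:
  assumes "0 < \<sigma>" "distributed \<mu> lborel (\<lambda>x. a \<bullet> x) (\<lambda>x. ennreal (normal_density 0 \<sigma> x))"
  shows "cov a a = \<sigma>\<^sup>2"
  using normal_distributed_variance[OF assms] by (simp add: cov_def mean_zero power2_eq_square)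

text \<open>A degenerate marginal fits the same formula with variance 0. Hence the law is determined
  by \<open>cov\<close>, and identities in law reduce to algebra with this bilinear form.\<close>

lemma char_gaussian: "(CLINT x|\<mu>. iexp (a \<bullet> x)) = exp (- cov a a / 2)"
proof (cases rule: marginal_cases[of a])
  case degenerate
  then have "(CLINT x|\<mu>. iexp (a \<bullet> x)) = (CLINT x|\<mu>. 1)"
    by (intro integral_cong_AE) auto
  moreover have "cov a a = 0"
    unfolding cov_def using degenerate by (intro integral_eq_zero_AE) auto
  ultimately show ?thesis using prob_space by simp
next
  case (normal \<sigma>)
  have "distributed \<mu> lborel (\<lambda>x. (a \<bullet> x - 0) / \<sigma>) std_normal_density"
    using normal_standard_normal_convert[OF normal(1), of "\<lambda>x. a \<bullet> x" 0] normal(2) by simp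
  then have D: "distr \<mu> lborel (\<lambda>x. (a \<bullet> x) / \<sigma>) = std_normal_distribution"
    by (simp add: distributed_def)
  have "(CLINT x|\<mu>. iexp (a \<bullet> x)) = (CLINT x|\<mu>. iexp (\<sigma> * ((a \<bullet> x) / \<sigma>)))"
    using normal(1) by simp
  also have "\<dots> = char (distr \<mu> lborel (\<lambda>x. (a \<bullet> x) / \<sigma>)) \<sigma>"
    unfolding char_def by (subst integral_distr) auto
  also have "\<dots> = exp (- cov a a / 2)"
    unfolding D char_std_normal_distribution normal_cov[OF normal] by simp
  finally show ?thesis .
qed

lemma integrable_norm_square: "integrable \<mu> (\<lambda>x. (norm x)\<^sup>2)"
proof -
  have "(norm x)\<^sup>2 = (\<Sum>b\<in>Basis. (b \<bullet> x)\<^sup>2)" for x :: 'a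
    unfolding power2_norm_eq_inner euclidean_inner[of x x] by (simp add: power2_eq_square inner_commute)
  then show ?thesis by (simp only:) (intro Bochner_Integration.integrable_sum integrable_square)
qed

lemma integrable_norm: "integrable \<mu> norm"
  by (rule square_integrable_imp_integrable[OF _ integrable_norm_square]) measurable

lemma inner_mult_inner_le: "\<bar>(a \<bullet> x) * (b \<bullet> x)\<bar> \<le> norm a * norm b * (norm x)\<^sup>2" for a b x :: 'a
  using mult_mono[OF Cauchy_Schwarz_ineq2[of a x] Cauchy_Schwarz_ineq2[of b x]]
  by (simp add: abs_mult power2_eq_square mult_ac)

lemma integrable_inner_mult: "integrable \<mu> (\<lambda>x. (a \<bullet> x) * (b \<bullet> x))"
proof (rule Bochner_Integration.integrable_bound)
  show "integrable \<mu> (\<lambda>x. norm a * norm b * (norm x)\<^sup>2)" using integrable_norm_square by simp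
  show "AE x in \<mu>. norm ((a \<bullet> x) * (b \<bullet> x)) \<le> norm (norm a * norm b * (norm x)\<^sup>2)"
    unfolding real_norm_def by (intro AE_I2 order_trans[OF inner_mult_inner_le abs_ge_self])
qed measurable

lemma bounded_bilinear_cov: "bounded_bilinear cov"
proof
  fix a a' b b' :: 'a and r :: real
  show "cov (a + a') b = cov a b + cov a' b" "cov a (b + b') = cov a b + cov a b'"
    unfolding cov_def using integrable_inner_mult by (simp_all add: inner_add_left algebra_simps)
  show "cov (r *\<^sub>R a) b = r *\<^sub>R cov a b" "cov a (r *\<^sub>R b) = r *\<^sub>R cov a b"
    unfolding cov_def by (simp_all add: mult_ac)
  have "norm (cov a b) \<le> norm a * norm b * (LINT x|\<mu>. (norm x)\<^sup>2)" for a b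
  proof -
    have "norm (cov a b) \<le> (LINT x|\<mu>. norm ((a \<bullet> x) * (b \<bullet> x)))"
      unfolding cov_def by (rule integral_norm_bound)
    also have "\<dots> \<le> (LINT x|\<mu>. norm a * norm b * (norm x)\<^sup>2)"
    proof (rule integral_mono)
      show "norm ((a \<bullet> x) * (b \<bullet> x)) \<le> norm a * norm b * (norm x)\<^sup>2" for x
        unfolding real_norm_def by (rule inner_mult_inner_le)
    qed (use integrable_inner_mult integrable_norm_square in auto)
    finally show ?thesis by simp
  qed
  then show "\<exists>K. \<forall>a b. norm (cov a b) \<le> norm a * norm b * K" by blast
qed

sublocale cov: bounded_bilinear cov by (rule bounded_bilinear_cov)

lemma cov_commute: "cov a b = cov b a"
  by (simp add: cov_def mult.commute)

lemma measurable_cov [measurable (raw)]: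
  assumes "f \<in> borel_measurable M" "g \<in> borel_measurable M"
  shows "(\<lambda>x. cov (f x) (g x)) \<in> borel_measurable M"
  by (rule borel_measurable_continuous_Pair[OF assms])
    (auto intro!: cov.continuous_on continuous_intros)

text \<open>The vector integral is the covariance operator applied to \<open>b\<close>; divided by
  the variance of b \<bullet> x it becomes the regression direction.\<close>

lemma cov_eq_inner: "cov a b = a \<bullet> (LINT x|\<mu>. (b \<bullet> x) *\<^sub>R x)"
proof -
  have "integrable \<mu> (\<lambda>x. (b \<bullet> x) *\<^sub>R x)"
  proof (rule Bochner_Integration.integrable_bound)
    show "integrable \<mu> (\<lambda>x. norm b * (norm x)\<^sup>2)" using integrable_norm_square by simp
    have "\<bar>b \<bullet> x\<bar> * norm x \<le> norm b * (norm x)\<^sup>2" for x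
      using mult_right_mono[OF Cauchy_Schwarz_ineq2[of b x] norm_ge_zero[of x]]
      by (simp add: power2_eq_square mult_ac)
    then show "AE x in \<mu>. norm ((b \<bullet> x) *\<^sub>R x) \<le> norm (norm b * (norm x)\<^sup>2)" by simp
  qed measurable
  then show ?thesis by (simp add: cov_def mult_ac flip: integral_inner_right)
qed

section \<open>Identities in law for two independent copies\<close>

lemma prob_space_pair_self: "prob_space (\<mu> \<Otimes>\<^sub>M \<mu>)"
proof -
  interpret pair_prob_space \<mu> \<mu> ..
  show ?thesis by unfold_locales
qed

lemma sets_pair_self: "sets (\<mu> \<Otimes>\<^sub>M \<mu>) = sets (borel :: ('a \<times> 'a) measure)"
  by (simp add: borel_prod[symmetric] cong: sets_pair_measure_cong)

lemma char_pair: "(CLINT p|(\<mu> \<Otimes>\<^sub>M \<mu>). iexp (a \<bullet> fst p + b \<bullet> snd p)) = exp (- (cov a a + cov b b) / 2)"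
proof -
  interpret pair_prob_space \<mu> \<mu> ..
  have "integrable (\<mu> \<Otimes>\<^sub>M \<mu>) (\<lambda>p. iexp (a \<bullet> fst p + b \<bullet> snd p))"
    by (rule integrable_const_bound[where B = 1]) auto
  from integral_fst'[OF this]
  have "(CLINT p|(\<mu> \<Otimes>\<^sub>M \<mu>). iexp (a \<bullet> fst p + b \<bullet> snd p)) =
      (CLINT x|\<mu>. CLINT y|\<mu>. iexp (a \<bullet> x) * iexp (b \<bullet> y))"
    by (simp add: algebra_simps exp_add)
  also have "\<dots> = complex_of_real (exp (- cov a a / 2)) * complex_of_real (exp (- cov b b / 2))"
    by (simp add: char_gaussian[unfolded complex_of_real_def[symmetric]])
  also have "\<dots> = exp (- (cov a a + cov b b) / 2)"
    by (simp add: add_divide_distrib flip: of_real_mult exp_add)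
  finally show ?thesis .
qed

text \<open>The characteristic function of the pair depends on (a, b) only through cov a a + cov b
  b, and in this sum the cross terms created by a rotation cancel.\<close>

lemma rotation_invariant:
  assumes "c\<^sup>2 + s\<^sup>2 = 1"
  shows "distr (\<mu> \<Otimes>\<^sub>M \<mu>) borel (\<lambda>p. (c *\<^sub>R fst p + s *\<^sub>R snd p, - s *\<^sub>R fst p + c *\<^sub>R snd p)) = \<mu> \<Otimes>\<^sub>M \<mu>"
    (is "distr _ _ ?R = _")
proof (rule char_uniqueness_euclidean)
  interpret P: prob_space "\<mu> \<Otimes>\<^sub>M \<mu>" by (rule prob_space_pair_self)
  have [measurable]: "?R \<in> measurable (\<mu> \<Otimes>\<^sub>M \<mu>) borel"
    by (subst borel_prod[symmetric]) measurable
  show "prob_space (\<mu> \<Otimes>\<^sub>M \<mu>)" "prob_space (distr (\<mu> \<Otimes>\<^sub>M \<mu>) borel ?R)"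
    by (auto intro!: P.prob_space_distr prob_space_pair_self)
  show "sets (\<mu> \<Otimes>\<^sub>M \<mu>) = sets borel" "sets (distr (\<mu> \<Otimes>\<^sub>M \<mu>) borel ?R) = sets borel"
    by (rule sets_pair_self, rule sets_distr)
  fix q :: "'a \<times> 'a"
  obtain a b where q: "q = (a, b)" by (cases q)
  have "(CLINT x|distr (\<mu> \<Otimes>\<^sub>M \<mu>) borel ?R. iexp (q \<bullet> x)) = (CLINT p|(\<mu> \<Otimes>\<^sub>M \<mu>). iexp (q \<bullet> ?R p))"
    by (rule integral_distr) auto
  also have "\<dots> = (CLINT p|(\<mu> \<Otimes>\<^sub>M \<mu>). iexp ((c *\<^sub>R a - s *\<^sub>R b) \<bullet> fst p + (s *\<^sub>R a + c *\<^sub>R b) \<bullet> snd p))"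
    by (intro Bochner_Integration.integral_cong refl arg_cong[where f = iexp])
      (simp add: q inner_prod_def inner_simps algebra_simps)
  also have "\<dots> = exp (- (cov (c *\<^sub>R a - s *\<^sub>R b) (c *\<^sub>R a - s *\<^sub>R b)
      + cov (s *\<^sub>R a + c *\<^sub>R b) (s *\<^sub>R a + c *\<^sub>R b)) / 2)"
    by (rule char_pair)
  also have "cov (c *\<^sub>R a - s *\<^sub>R b) (c *\<^sub>R a - s *\<^sub>R b) + cov (s *\<^sub>R a + c *\<^sub>R b) (s *\<^sub>R a + c *\<^sub>R b)
      = (c\<^sup>2 + s\<^sup>2) * (cov a a + cov b b)"
    by (simp add: cov.add_left cov.add_right cov.diff_left cov.diff_right cov.scaleR_left cov.scaleR_right
        cov_commute[of b a] power2_eq_square algebra_simps)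
  also have "complex_of_real (exp (- ((c\<^sup>2 + s\<^sup>2) * (cov a a + cov b b)) / 2)) =
      (CLINT p|(\<mu> \<Otimes>\<^sub>M \<mu>). iexp (a \<bullet> fst p + b \<bullet> snd p))"
    unfolding assms char_pair by simp
  finally show "(CLINT x|distr (\<mu> \<Otimes>\<^sub>M \<mu>) borel ?R. iexp (q \<bullet> x)) = (CLINT x|(\<mu> \<Otimes>\<^sub>M \<mu>). iexp (q \<bullet> x))"
    by (simp add: q inner_prod_def)
qed

text \<open>The regression of \<open>x\<close> on \<open>b \<bullet> x\<close>: the residual is uncorrelated with, hence independent of, \<open>b \<bullet> x\<close>.\<close>

lemma regression:
  assumes b: "cov b b \<noteq> 0"
  defines "v \<equiv> (LINT x|\<mu>. (b \<bullet> x) *\<^sub>R x) /\<^sub>R cov b b"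
  shows "distr (\<mu> \<Otimes>\<^sub>M \<mu>) borel (\<lambda>p. (b \<bullet> fst p) *\<^sub>R v + (snd p - (b \<bullet> snd p) *\<^sub>R v)) = \<mu>"
    (is "distr _ _ ?R = _")
proof (rule char_uniqueness_euclidean)
  interpret P: prob_space "\<mu> \<Otimes>\<^sub>M \<mu>" by (rule prob_space_pair_self)
  have av: "a \<bullet> v = cov a b / cov b b" for a
    unfolding v_def by (simp add: cov_eq_inner[of a b] field_simps)
  have [measurable]: "?R \<in> measurable (\<mu> \<Otimes>\<^sub>M \<mu>) borel" by measurable
  show "prob_space \<mu>" "prob_space (distr (\<mu> \<Otimes>\<^sub>M \<mu>) borel ?R)"
    by (auto intro!: P.prob_space_distr prob_space_axioms)
  fix a :: 'a
  have "(CLINT x|distr (\<mu> \<Otimes>\<^sub>M \<mu>) borel ?R. iexp (a \<bullet> x)) = (CLINT p|(\<mu> \<Otimes>\<^sub>M \<mu>). iexp (a \<bullet> ?R p))"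
    by (rule integral_distr) auto
  also have "\<dots> = (CLINT p|(\<mu> \<Otimes>\<^sub>M \<mu>). iexp (((a \<bullet> v) *\<^sub>R b) \<bullet> fst p + (a - (a \<bullet> v) *\<^sub>R b) \<bullet> snd p))"
    by (intro Bochner_Integration.integral_cong refl arg_cong[where f = iexp])
      (simp add: inner_simps algebra_simps)
  also have "\<dots> = exp (- (cov ((a \<bullet> v) *\<^sub>R b) ((a \<bullet> v) *\<^sub>R b)
      + cov (a - (a \<bullet> v) *\<^sub>R b) (a - (a \<bullet> v) *\<^sub>R b)) / 2)"
    by (rule char_pair)
  \<comment> \<open>Explained plus residual variance: (cov a b)^2 / cov b b is added by the first
    summand and removed by the second.\<close>
  also have "cov ((a \<bullet> v) *\<^sub>R b) ((a \<bullet> v) *\<^sub>R b) + cov (a - (a \<bullet> v) *\<^sub>R b) (a - (a \<bullet> v) *\<^sub>R b) = cov a a"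
    using b by (simp add: av cov.diff_left cov.diff_right cov.scaleR_left cov.scaleR_right
        cov_commute[of b a] field_simps)
  finally show "(CLINT x|distr (\<mu> \<Otimes>\<^sub>M \<mu>) borel ?R. iexp (a \<bullet> x)) = (CLINT x|\<mu>. iexp (a \<bullet> x))"
    by (simp add: char_gaussian)
qed simp_all

section \<open>Gaussian integration by parts and the covariance formula\<close>

lemma integrable_lipschitz_mult_inner:
  assumes le: "\<And>x. \<bar>g x\<bar> \<le> A + L * norm x" and g: "g \<in> borel_measurable borel"
  shows "integrable \<mu> (\<lambda>x. g x * (b \<bullet> x))"
proof -
  note [measurable] = g
  have i: "integrable \<mu> (\<lambda>x. norm b * (A * norm x + L * (norm x)\<^sup>2))"
    using integrable_norm_square integrable_norm by simp
  have bound: "\<bar>g x * (b \<bullet> x)\<bar> \<le> norm b * (A * norm x + L * (norm x)\<^sup>2)" for x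
  proof -
    have "\<bar>g x\<bar> * \<bar>b \<bullet> x\<bar> \<le> (A + L * norm x) * (norm b * norm x)"
      using le[of x] by (intro mult_mono Cauchy_Schwarz_ineq2) auto
    then show ?thesis by (simp add: abs_mult power2_eq_square algebra_simps)
  qed
  show ?thesis
  proof (rule Bochner_Integration.integrable_bound[OF i])
    show "(\<lambda>x. g x * (b \<bullet> x)) \<in> borel_measurable \<mu>" by measurable
    show "AE x in \<mu>. norm (g x * (b \<bullet> x)) \<le> norm (norm b * (A * norm x + L * (norm x)\<^sup>2))"
      unfolding real_norm_def by (intro AE_I2 order_trans[OF bound abs_ge_self])
  qed
qed

text \<open>With the residual frozen, g is a function of the single normal variable s = b \<bullet>
  x along the direction \<open>v\<close>. Its derivative is G \<bullet> v = cov G b / cov b b, and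
  the variance produced by the one-dimensional formula cancels the denominator. For a degenerate b
  \<bullet> x both sides are 0.\<close>

lemma integration_by_parts:
  assumes d: "\<And>x. (g has_derivative (\<lambda>h. G x \<bullet> h)) (at x)"
    and c: "continuous_on UNIV G" and L: "\<And>x. norm (G x) \<le> L"
  shows "(LINT x|\<mu>. g x * (b \<bullet> x)) = (LINT x|\<mu>. cov (G x) b)"
proof (cases "cov b b = 0")
  case True
  have "AE x in \<mu>. b \<bullet> x = 0"
  proof (cases rule: marginal_cases[of b])
    case (normal \<sigma>)
    with normal_cov[OF normal] True show ?thesis by simp
  qed
  moreover from this have "cov a b = (LINT x|\<mu>. 0)" for a
    unfolding cov_def by (intro integral_cong_AE) auto
  moreover have [measurable]: "g \<in> borel_measurable borel"
    using has_derivative_continuous[OF d]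
    by (auto intro!: borel_measurable_continuous_onI simp: continuous_on_eq_continuous_at)
  ultimately show ?thesis
    by (auto intro!: integral_eq_zero_AE)
next
  case False
  have [measurable]: "g \<in> borel_measurable borel" "G \<in> borel_measurable borel"
    using has_derivative_continuous[OF d] c
    by (auto intro!: borel_measurable_continuous_onI simp: continuous_on_eq_continuous_at)
  obtain B where B: "\<And>x y. norm (cov x y) \<le> norm x * norm y * B" "0 \<le> B"
    using cov.nonneg_bounded by blast
  have "norm (cov (G x) b) \<le> L * norm b * B" for x
    using order_trans[OF B(1) mult_right_mono[OF mult_right_mono[OF L norm_ge_zero] B(2)]] .
  then have i2: "integrable \<mu> (\<lambda>x. cov (G x) b)"
    by (intro integrable_const_bound[where B = "L * norm b * B"] AE_I2) auto
  interpret pair_prob_space \<mu> \<mu> ..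
  from False obtain \<sigma> where \<sigma>: "0 < \<sigma>"
    and n: "distributed \<mu> lborel (\<lambda>x. b \<bullet> x) (\<lambda>x. ennreal (normal_density 0 \<sigma> x))"
  proof (cases rule: marginal_cases[of b])
    case degenerate
    then have "cov b b = (LINT x|\<mu>. 0)" unfolding cov_def by (intro integral_cong_AE) auto
    with False show ?thesis by simp
  qed blast
  define v where "v = (LINT x|\<mu>. (b \<bullet> x) *\<^sub>R x) /\<^sub>R cov b b"
  have av: "a \<bullet> v = cov a b / cov b b" for a
    unfolding v_def by (simp add: cov_eq_inner[of a b] field_simps)
  \<comment> \<open>Together with \<open>br\<close> below this makes \<open>s\<close> the value of b
    \<bullet> x at the point s v + r y.\<close>
  then have bv: "b \<bullet> v = 1" using False by simp
  define r where "r y = y - (b \<bullet> y) *\<^sub>R v" for y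
  have br: "b \<bullet> r y = 0" for y by (simp add: r_def inner_simps bv)
  note law = regression[OF False, folded v_def, folded r_def]
  have [measurable]: "r \<in> borel_measurable borel" unfolding r_def by measurable
  have R [measurable]: "(\<lambda>p. (b \<bullet> fst p) *\<^sub>R v + r (snd p)) \<in> measurable (\<mu> \<Otimes>\<^sub>M \<mu>) borel" by measurable
  have transfer: "(LINT x|\<mu>. h x) = (LINT y|\<mu>. LINT x|\<mu>. h ((b \<bullet> x) *\<^sub>R v + r y))"
    if [measurable]: "h \<in> borel_measurable borel" and h: "integrable \<mu> h" for h :: "'a \<Rightarrow> real"
  proof -
    have h': "integrable (\<mu> \<Otimes>\<^sub>M \<mu>) (\<lambda>p. h ((b \<bullet> fst p) *\<^sub>R v + r (snd p)))"
      using h by (subst (asm) law[symmetric]) (simp add: integrable_distr_eq)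
    have "(LINT x|\<mu>. h x) = (LINT p|(\<mu> \<Otimes>\<^sub>M \<mu>). h ((b \<bullet> fst p) *\<^sub>R v + r (snd p)))"
      by (subst law[symmetric]) (simp add: integral_distr)
    also have "\<dots> = (LINT y|\<mu>. LINT x|\<mu>. h ((b \<bullet> x) *\<^sub>R v + r y))"
      using integral_snd[of "\<lambda>x y. h ((b \<bullet> x) *\<^sub>R v + r y)"] h' by (simp add: case_prod_unfold)
    finally show ?thesis .
  qed
  have inner: "(LINT x|\<mu>. g ((b \<bullet> x) *\<^sub>R v + w) * (b \<bullet> x)) = (LINT x|\<mu>. cov (G ((b \<bullet> x) *\<^sub>R v + w)) b)" for w
  proof -
    have [measurable]: "(\<lambda>s. g (s *\<^sub>R v + w)) \<in> borel_measurable borel" "(\<lambda>s. G (s *\<^sub>R v + w)) \<in> borel_measurable borel"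
      by measurable
    have "(LINT x|\<mu>. g ((b \<bullet> x) *\<^sub>R v + w) * (b \<bullet> x)) = (LBINT s. normal_density 0 \<sigma> s * (s * g (s *\<^sub>R v + w)))"
      by (subst distributed_integral[OF n]) (auto simp: mult.commute)
    also have "\<dots> = \<sigma>\<^sup>2 * (LBINT s. normal_density 0 \<sigma> s * (G (s *\<^sub>R v + w) \<bullet> v))"
    proof (rule normal_density_integration_by_parts[OF \<sigma>])
      show "((\<lambda>s. g (s *\<^sub>R v + w)) has_real_derivative G (s *\<^sub>R v + w) \<bullet> v) (at s)" for s
        by (rule has_real_derivative_along_line[OF d]) (auto intro!: derivative_eq_intros)
      show "isCont (\<lambda>s. G (s *\<^sub>R v + w) \<bullet> v) s" for s
      proof -
        have "isCont G (s *\<^sub>R v + w)" using c by (simp add: continuous_on_eq_continuous_at)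
        then have "isCont (\<lambda>s. G (s *\<^sub>R v + w)) s"
          by (rule isCont_o2[rotated]) (intro continuous_intros)
        then show ?thesis by (intro continuous_intros)
      qed
      show "\<bar>G (s *\<^sub>R v + w) \<bullet> v\<bar> \<le> L * norm v" for s
        by (rule order_trans[OF Cauchy_Schwarz_ineq2]) (auto intro!: mult_right_mono L)
    qed
    also have "\<dots> = (LBINT s. normal_density 0 \<sigma> s * cov (G (s *\<^sub>R v + w)) b)"
      using \<sigma> by (simp add: av normal_cov[OF \<sigma> n])
    also have "\<dots> = (LINT x|\<mu>. cov (G ((b \<bullet> x) *\<^sub>R v + w)) b)"
      by (subst distributed_integral[OF n]) auto
    finally show ?thesis .
  qed
  have "\<bar>g x\<bar> \<le> \<bar>g 0\<bar> + L * norm x" for x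
    using gradient_lipschitz[OF d L, of x 0] by simp
  then have i1: "integrable \<mu> (\<lambda>x. g x * (b \<bullet> x))"
    by (rule integrable_lipschitz_mult_inner) simp
  have "(LINT x|\<mu>. g x * (b \<bullet> x)) = (LINT y|\<mu>. LINT x|\<mu>. g ((b \<bullet> x) *\<^sub>R v + r y) * (b \<bullet> x))"
    by (subst transfer[OF _ i1]) (auto simp: inner_add_right bv br)
  also have "\<dots> = (LINT y|\<mu>. LINT x|\<mu>. cov (G ((b \<bullet> x) *\<^sub>R v + r y)) b)"
    by (simp add: inner)
  also have "\<dots> = (LINT x|\<mu>. cov (G x) b)"
    by (rule transfer[OF _ i2, symmetric]) measurable
  finally show ?thesis .
qed

lemma integrable_pair_quadratic:
  fixes f :: "'a \<times> 'a \<Rightarrow> real"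
  assumes f: "f \<in> borel_measurable (\<mu> \<Otimes>\<^sub>M \<mu>)"
    and B: "\<And>x y. \<bar>f (x, y)\<bar> \<le> B * (1 + norm x + norm y)\<^sup>2"
  shows "integrable (\<mu> \<Otimes>\<^sub>M \<mu>) f"
proof -
  interpret PP: pair_prob_space \<mu> \<mu> ..
  have B0: "0 \<le> B" using order_trans[OF abs_ge_zero B[of 0 0]] by simp
  have 1: "integrable (\<mu> \<Otimes>\<^sub>M \<mu>) (\<lambda>p. (norm (fst p))\<^sup>2)"
  proof (rule PP.Fubini_integrable)
    show "integrable \<mu> (\<lambda>x. LINT y|\<mu>. norm ((norm (fst (x, y)))\<^sup>2))"
      using integrable_norm_square by (simp add: prob_space[simplified])
  qed simp_all
  have 2: "integrable (\<mu> \<Otimes>\<^sub>M \<mu>) (\<lambda>p. (norm (snd p))\<^sup>2)"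
    using PP.integrable_product_swap[OF 1] by (simp add: case_prod_unfold)
  \<comment> \<open>The difference of the two sides is (u - v)^2 + (u - 1)^2 + (v - 1)^2.\<close>
  have sq: "(1 + u + v)\<^sup>2 \<le> 3 * (1 + u\<^sup>2 + v\<^sup>2)" for u v :: real
    using sum_squares_ge_zero[of "u - v" "u - 1"] zero_le_power2[of "v - 1"]
    by (simp add: power2_eq_square algebra_simps)
  have le: "\<bar>f p\<bar> \<le> 3 * B * (1 + (norm (fst p))\<^sup>2 + (norm (snd p))\<^sup>2)" for p
    using order_trans[OF B[of "fst p" "snd p"] mult_left_mono[OF sq B0]] by (simp add: mult_ac)
  show ?thesis
  proof (rule Bochner_Integration.integrable_bound)
    show "integrable (\<mu> \<Otimes>\<^sub>M \<mu>) (\<lambda>p. 3 * B * (1 + (norm (fst p))\<^sup>2 + (norm (snd p))\<^sup>2))"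
      using 1 2 by simp
    show "AE p in \<mu> \<Otimes>\<^sub>M \<mu>. norm (f p) \<le> norm (3 * B * (1 + (norm (fst p))\<^sup>2 + (norm (snd p))\<^sup>2))"
      unfolding real_norm_def by (intro AE_I2 order_trans[OF le abs_ge_self])
  qed (rule f)
qed

text \<open>Interpolate from \<open>H x\<close> to \<open>H y\<close> along \<open>cos t x + sin t y\<close>, with \<open>y\<close> an independent copy of \<open>x\<close>. After
  rotating the pair back, integration by parts in \<open>y\<close> evaluates the derivative in \<open>t\<close>.\<close>

theorem covariance_bounds:
  fixes F H :: "'a \<Rightarrow> real"
  assumes dF: "\<And>x. (F has_derivative (\<lambda>h. gF x \<bullet> h)) (at x)"
    and dH: "\<And>x. (H has_derivative (\<lambda>h. gH x \<bullet> h)) (at x)"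
    and cF: "continuous_on UNIV gF" and cH: "continuous_on UNIV gH"
    and LF: "\<And>x. norm (gF x) \<le> L" and LH: "\<And>x. norm (gH x) \<le> L"
    and m: "integrable \<mu> l" "integrable \<mu> u"
    and lb: "\<And>x y. l x \<le> cov (gH x) (gF y)" and ub: "\<And>x y. cov (gH x) (gF y) \<le> u x"
  shows "(LINT x|\<mu>. l x) \<le> (LINT x|\<mu>. F x * H x) - (LINT x|\<mu>. F x) * (LINT x|\<mu>. H x)"
    and "(LINT x|\<mu>. F x * H x) - (LINT x|\<mu>. F x) * (LINT x|\<mu>. H x) \<le> (LINT x|\<mu>. u x)"
proof -
  have [measurable]: "F \<in> borel_measurable borel" "H \<in> borel_measurable borel"
      "gF \<in> borel_measurable borel" "gH \<in> borel_measurable borel"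
    using has_derivative_continuous[OF dF] has_derivative_continuous[OF dH] cF cH
    by (auto intro!: borel_measurable_continuous_onI simp: continuous_on_eq_continuous_at)
  have L0: "0 \<le> L" using order_trans[OF norm_ge_zero LF] .
  obtain K where K: "\<And>x y. norm (cov x y) \<le> norm x * norm y * K" "0 \<le> K"
    using cov.nonneg_bounded by blast
  have "norm (cov (gH x) (gF y)) \<le> L * L * K" for x y
    using order_trans[OF K(1) mult_right_mono[OF mult_mono[OF LH LF L0 norm_ge_zero] K(2)]] .
  then have int_cov: "integrable \<mu> (\<lambda>y. cov (gH x) (gF (c *\<^sub>R x - s *\<^sub>R y)))" for c s x
    by (intro integrable_const_bound[where B = "L * L * K"] AE_I2) auto
  define A where "A = \<bar>F 0\<bar> + \<bar>H 0\<bar> + L"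
  have A: "\<bar>F 0\<bar> \<le> A" "\<bar>H 0\<bar> \<le> A" "L \<le> A" "0 \<le> A" using L0 by (auto simp: A_def)
  have bF: "\<bar>F z\<bar> \<le> A * (1 + r)" and bH: "\<bar>H z\<bar> \<le> A * (1 + r)" if "norm z \<le> r" for z r
  proof -
    have "L * norm z \<le> A * r" using that A by (intro mult_mono) auto
    moreover have "\<bar>F z\<bar> \<le> \<bar>F 0\<bar> + L * norm z" "\<bar>H z\<bar> \<le> \<bar>H 0\<bar> + L * norm z"
      using gradient_lipschitz[OF dF LF, of z 0] gradient_lipschitz[OF dH LH, of z 0] by simp_all
    moreover have "\<bar>F 0\<bar> + A * r \<le> A * (1 + r)" "\<bar>H 0\<bar> + A * r \<le> A * (1 + r)"
      using A by (simp_all add: algebra_simps)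
    ultimately show "\<bar>F z\<bar> \<le> A * (1 + r)" "\<bar>H z\<bar> \<le> A * (1 + r)" by linarith+
  qed
  have bg: "\<bar>gH z \<bullet> w\<bar> \<le> A * (1 + r)" if "norm w \<le> r" for z w r
  proof -
    have "\<bar>gH z \<bullet> w\<bar> \<le> norm (gH z) * norm w" by (rule Cauchy_Schwarz_ineq2)
    also have "\<dots> \<le> A * r" using that A LH[of z] by (intro mult_mono) auto
    also have "\<dots> \<le> A * (1 + r)" using A by (simp add: algebra_simps)
    finally show ?thesis .
  qed
  have quad: "\<bar>a * b\<bar> \<le> A\<^sup>2 * (1 + norm x + norm y)\<^sup>2"
    if "\<bar>a\<bar> \<le> A * (1 + (norm x + norm y))" "\<bar>b\<bar> \<le> A * (1 + (norm x + norm y))" for a b and x y :: 'a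
    using mult_mono[OF that] A by (simp add: abs_mult power2_eq_square mult_ac add_ac)
  have rot: "norm (c *\<^sub>R x + s *\<^sub>R y) \<le> norm x + norm y" "norm (c *\<^sub>R x - s *\<^sub>R y) \<le> norm x + norm y"
    if "\<bar>c\<bar> \<le> 1" "\<bar>s\<bar> \<le> 1" for c s and x y :: 'a
  proof -
    have "norm (c *\<^sub>R x) \<le> norm x" "norm (s *\<^sub>R y) \<le> norm y"
      using that by (auto intro: mult_left_le_one_le)
    then show "norm (c *\<^sub>R x + s *\<^sub>R y) \<le> norm x + norm y" "norm (c *\<^sub>R x - s *\<^sub>R y) \<le> norm x + norm y"
      using norm_triangle_ineq[of "c *\<^sub>R x" "s *\<^sub>R y"] norm_triangle_ineq4[of "c *\<^sub>R x" "s *\<^sub>R y"] by linarith+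
  qed
  define Q where "Q = \<mu> \<Otimes>\<^sub>M \<mu>"
  have [measurable_cong]: "sets Q = sets (borel \<Otimes>\<^sub>M borel)"
    unfolding Q_def by (rule sets_pair_measure_cong) simp_all
  interpret PP: pair_prob_space \<mu> \<mu> ..
  interpret Q: prob_space Q unfolding Q_def by (rule prob_space_pair_self)
  interpret QL: pair_sigma_finite Q lborel ..
  \<comment> \<open>F(x) times the t-derivative of H along the interpolating path. Over [0, pi/2] it
    integrates to F(x) (H(y) - H(x)), whose expectation is minus the covariance of F and H.\<close>
  define \<Phi> where "\<Phi> t p = F (fst p) * (gH (cos t *\<^sub>R fst p + sin t *\<^sub>R snd p) \<bullet> (cos t *\<^sub>R snd p - sin t *\<^sub>R fst p))"
    for t and p :: "'a \<times> 'a"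
  let ?I = "indicator {0..pi/2} :: real \<Rightarrow> real"
  let ?b = "\<lambda>p :: 'a \<times> 'a. A\<^sup>2 * (1 + norm (fst p) + norm (snd p))\<^sup>2"
  have \<Phi>_le: "\<bar>\<Phi> t p\<bar> \<le> ?b p" for t p
    unfolding \<Phi>_def using rot(2)[of "cos t" "sin t" "snd p" "fst p"]
    by (intro quad bF bg) (auto simp: add.commute)
  have \<Phi>_meas [measurable]: "(\<lambda>(p, t). \<Phi> t p) \<in> borel_measurable (Q \<Otimes>\<^sub>M lborel)"
    unfolding \<Phi>_def by measurable
  have ib: "integrable Q ?b"
    unfolding Q_def by (rule integrable_pair_quadratic[where B = "A\<^sup>2"]) simp_all
  have iprod: "integrable (Q \<Otimes>\<^sub>M lborel) (\<lambda>(p, t). ?b p * ?I t)"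
  proof (rule QL.Fubini_integrable)
    show "integrable Q (\<lambda>p. LBINT t. norm (case (p, t) of (p, t) \<Rightarrow> ?b p * ?I t))"
      using ib by (simp add: abs_mult)
  qed (simp_all, measurable)
  have i\<Phi>: "integrable (Q \<Otimes>\<^sub>M lborel) (\<lambda>(p, t). ?I t * \<Phi> t p)"
  proof (rule Bochner_Integration.integrable_bound[OF iprod])
    show "(\<lambda>(p, t). ?I t * \<Phi> t p) \<in> borel_measurable (Q \<Otimes>\<^sub>M lborel)"
      using \<Phi>_meas by (simp add: case_prod_unfold)
    show "AE z in Q \<Otimes>\<^sub>M lborel. norm (case z of (p, t) \<Rightarrow> ?I t * \<Phi> t p) \<le> norm (case z of (p, t) \<Rightarrow> ?b p * ?I t)"
      using \<Phi>_le by (intro AE_I2) (auto simp: indicator_def)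
  qed
  have FTC: "(LBINT t. ?I t * \<Phi> t p) = F (fst p) * H (snd p) - F (fst p) * H (fst p)" for p
  proof -
    let ?\<gamma> = "\<lambda>t. cos t *\<^sub>R fst p + sin t *\<^sub>R snd p"
    have \<gamma>: "(?\<gamma> has_vector_derivative (cos t *\<^sub>R snd p - sin t *\<^sub>R fst p)) (at t)" for t
      by (auto intro!: derivative_eq_intros)
    have "(LBINT t. \<Phi> t p * ?I t) = F (fst p) * H (?\<gamma> (pi/2)) - F (fst p) * H (?\<gamma> 0)"
    proof (rule integral_FTC_Icc_real)
      show "((\<lambda>t. F (fst p) * H (?\<gamma> t)) has_real_derivative \<Phi> t p) (at t)" for t
        unfolding \<Phi>_def by (rule DERIV_cmult has_real_derivative_along_line[OF dH \<gamma>])+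
      show "isCont (\<lambda>t. \<Phi> t p) t" for t
      proof -
        have "isCont (\<lambda>t. gH (?\<gamma> t)) t"
          by (rule isCont_o2[where g = gH]) (use cH in \<open>auto simp: continuous_on_eq_continuous_at intro!: continuous_intros\<close>)
        then show ?thesis unfolding \<Phi>_def by (intro continuous_intros)
      qed
    qed simp
    then show ?thesis by (simp add: mult.commute)
  qed
  have E: "sin t * (LINT x|\<mu>. l x) \<le> - (LINT p|Q. \<Phi> t p)" "- (LINT p|Q. \<Phi> t p) \<le> sin t * (LINT x|\<mu>. u x)"
    if t: "t \<in> {0..pi/2}" for t
  proof -
    define c s where "c = cos t" and "s = sin t"
    have cs: "c\<^sup>2 + s\<^sup>2 = 1" "\<bar>c\<bar> \<le> 1" "\<bar>s\<bar> \<le> 1" by (simp_all add: c_def s_def)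
    have s0: "0 \<le> s" unfolding s_def using t by (intro sin_ge_zero) auto
    \<comment> \<open>\<Phi> in the rotated coordinates: the position on the path is the first
      component, its velocity the second, and the original x is c times the first minus s times the
      second. The rotated pair again has independent components.\<close>
    define \<Psi> where "\<Psi> p = F (c *\<^sub>R fst p - s *\<^sub>R snd p) * (gH (fst p) \<bullet> snd p)" for p :: "'a \<times> 'a"
    let ?R = "\<lambda>p. (c *\<^sub>R fst p + s *\<^sub>R snd p, - s *\<^sub>R fst p + c *\<^sub>R snd p)"
    have R [measurable]: "?R \<in> measurable Q borel"
      by (subst borel_prod[symmetric]) measurable
    have [measurable]: "\<Psi> \<in> borel_measurable (borel \<Otimes>\<^sub>M borel)" unfolding \<Psi>_def by measurable
    then have \<Psi>b: "\<Psi> \<in> borel_measurable borel" by (simp add: borel_prod)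
    have i\<Psi>: "integrable (\<mu> \<Otimes>\<^sub>M \<mu>) \<Psi>"
    proof (rule integrable_pair_quadratic)
      show "\<bar>\<Psi> (x, y)\<bar> \<le> A\<^sup>2 * (1 + norm x + norm y)\<^sup>2" for x y
        unfolding \<Psi>_def using rot(2)[OF cs(2,3), of x y] by (intro quad bF bg) auto
    qed measurable
    have \<Phi>\<Psi>: "\<Phi> t p = \<Psi> (?R p)" for p
    proof -
      have "c *\<^sub>R (c *\<^sub>R fst p + s *\<^sub>R snd p) - s *\<^sub>R (- s *\<^sub>R fst p + c *\<^sub>R snd p) = (c\<^sup>2 + s\<^sup>2) *\<^sub>R fst p"
        by (simp add: algebra_simps power2_eq_square)
      then show ?thesis
        unfolding \<Phi>_def \<Psi>_def by (simp add: cs(1) c_def[symmetric] s_def[symmetric])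
    qed
    have "(LINT p|Q. \<Phi> t p) = (LINT p|distr Q borel ?R. \<Psi> p)"
      unfolding \<Phi>\<Psi> by (rule integral_distr[symmetric, OF R \<Psi>b])
    also have "\<dots> = (LINT p|(\<mu> \<Otimes>\<^sub>M \<mu>). \<Psi> p)"
      unfolding Q_def rotation_invariant[OF cs(1)] ..
    also have "\<dots> = (LINT x|\<mu>. LINT y|\<mu>. \<Psi> (x, y))"
      by (rule PP.integral_fst'[OF i\<Psi>, symmetric])
    finally have eq: "(LINT p|Q. \<Phi> t p) = (LINT x|\<mu>. LINT y|\<mu>. \<Psi> (x, y))" .
    \<comment> \<open>The velocity is now an independent Gaussian factor, so it can be integrated by
      parts; the inner derivative of F contributes the factor -s, which turns the minus sign of the
      covariance into a plus.\<close>
    have inner: "(LINT y|\<mu>. \<Psi> (x, y)) = - s * (LINT y|\<mu>. cov (gH x) (gF (c *\<^sub>R x - s *\<^sub>R y)))" for x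
    proof -
      have "(LINT y|\<mu>. F (c *\<^sub>R x - s *\<^sub>R y) * (gH x \<bullet> y)) = (LINT y|\<mu>. cov (- s *\<^sub>R gF (c *\<^sub>R x - s *\<^sub>R y)) (gH x))"
      proof (rule integration_by_parts)
        show "((\<lambda>y. F (c *\<^sub>R x - s *\<^sub>R y)) has_derivative (\<lambda>h. (- s *\<^sub>R gF (c *\<^sub>R x - s *\<^sub>R y)) \<bullet> h)) (at y)" for y
          by (rule has_derivative_eq_rhs[OF has_derivative_compose[OF _ dF]])
            (auto intro!: derivative_eq_intros)
        show "continuous_on UNIV (\<lambda>y. - s *\<^sub>R gF (c *\<^sub>R x - s *\<^sub>R y))"
          by (intro continuous_intros continuous_on_compose2[OF cF]) auto
        show "norm (- s *\<^sub>R gF (c *\<^sub>R x - s *\<^sub>R y)) \<le> L" for y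
          using mult_mono[OF cs(3) LF[of "c *\<^sub>R x - s *\<^sub>R y"]] by simp
      qed
      then show ?thesis
        by (simp add: \<Psi>_def cov.minus_left cov.scaleR_left cov_commute[of "gF _" "gH x"])
    qed
    \<comment> \<open>\<open>l x\<close> and \<open>u x\<close> bound the covariance whatever the
      point at which the gradient of F is taken, so they survive the average over y.\<close>
    have bounds: "l x \<le> (LINT y|\<mu>. cov (gH x) (gF (c *\<^sub>R x - s *\<^sub>R y)))"
      "(LINT y|\<mu>. cov (gH x) (gF (c *\<^sub>R x - s *\<^sub>R y))) \<le> u x" for x
      using integral_ge_const[OF int_cov, of "l x"] integral_le_const[OF int_cov, of _ _ _ "u x"] lb ub by auto
    have i: "integrable \<mu> (\<lambda>x. LINT y|\<mu>. \<Psi> (x, y))"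
      by (rule PP.integrable_fst'[OF i\<Psi>])
    have "(LINT x|\<mu>. s * l x) \<le> (LINT x|\<mu>. - (LINT y|\<mu>. \<Psi> (x, y)))"
      using m i bounds s0 by (intro integral_mono) (auto simp: inner intro: mult_left_mono)
    then show "sin t * (LINT x|\<mu>. l x) \<le> - (LINT p|Q. \<Phi> t p)"
      unfolding eq by (simp add: s_def)
    have "(LINT x|\<mu>. - (LINT y|\<mu>. \<Psi> (x, y))) \<le> (LINT x|\<mu>. s * u x)"
      using m i bounds s0 by (intro integral_mono) (auto simp: inner intro: mult_left_mono)
    then show "- (LINT p|Q. \<Phi> t p) \<le> sin t * (LINT x|\<mu>. u x)"
      unfolding eq by (simp add: s_def)
  qed
  have iFH1: "integrable Q (\<lambda>p. F (fst p) * H (snd p))"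
    unfolding Q_def
    by (rule integrable_pair_quadratic[where B = "A\<^sup>2"]) (auto intro!: quad bF bH)
  have iFH2: "integrable Q (\<lambda>p. F (fst p) * H (fst p))"
    unfolding Q_def
    by (rule integrable_pair_quadratic[where B = "A\<^sup>2"]) (auto intro!: quad bF bH)
  have "(LBINT t. (LINT p|Q. ?I t * \<Phi> t p)) = (LINT p|Q. (LBINT t. ?I t * \<Phi> t p))"
    using QL.Fubini_integral[OF i\<Phi>] by simp
  also have "\<dots> = (LINT p|Q. F (fst p) * H (snd p)) - (LINT p|Q. F (fst p) * H (fst p))"
    unfolding FTC by (rule Bochner_Integration.integral_diff[OF iFH1 iFH2])
  also have "(LINT p|Q. F (fst p) * H (snd p)) = (LINT x|\<mu>. F x) * (LINT x|\<mu>. H x)"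
    unfolding Q_def using PP.integral_fst'[OF iFH1[unfolded Q_def]] by simp
  also have "(LINT p|Q. F (fst p) * H (fst p)) = (LINT x|\<mu>. F x * H x)"
    unfolding Q_def using PP.integral_fst'[OF iFH2[unfolded Q_def]] prob_space by simp
  finally have cov_eq: "(LINT x|\<mu>. F x * H x) - (LINT x|\<mu>. F x) * (LINT x|\<mu>. H x) = (LBINT t. - (LINT p|Q. ?I t * \<Phi> t p))"
    by simp
  have iE: "integrable lborel (\<lambda>t. - (LINT p|Q. ?I t * \<Phi> t p))"
    using QL.integrable_snd[OF i\<Phi>] by simp
  \<comment> \<open>The weight sin t is nonnegative with integral 1 on [0, pi/2], so averaging over
    t preserves both bounds without loss.\<close>
  have hs: "has_bochner_integral lborel (\<lambda>t. sin t * ?I t) (- cos (pi/2) - - cos 0)"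
    by (rule has_bochner_integral_FTC_Icc_real) (auto intro!: derivative_eq_intros)
  then have si: "integrable lborel (\<lambda>t. sin t * ?I t * k)" "(LBINT t. sin t * ?I t * k) = k" for k
    by (auto simp: has_bochner_integral_iff)
  have "(LBINT t. sin t * ?I t * (LINT x|\<mu>. l x)) \<le> (LBINT t. - (LINT p|Q. ?I t * \<Phi> t p))"
    by (rule integral_mono[OF si(1) iE]) (use E(1) in \<open>auto simp: indicator_def\<close>)
  then show "(LINT x|\<mu>. l x) \<le> (LINT x|\<mu>. F x * H x) - (LINT x|\<mu>. F x) * (LINT x|\<mu>. H x)"
    unfolding cov_eq si(2) .
  have "(LBINT t. - (LINT p|Q. ?I t * \<Phi> t p)) \<le> (LBINT t. sin t * ?I t * (LINT x|\<mu>. u x))"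
    by (rule integral_mono[OF iE si(1)]) (use E(2) in \<open>auto simp: indicator_def\<close>)
  then show "(LINT x|\<mu>. F x * H x) - (LINT x|\<mu>. F x) * (LINT x|\<mu>. H x) \<le> (LINT x|\<mu>. u x)"
    unfolding cov_eq si(2) .
qed

end

section \<open>The maximum of a Gaussian vector\<close>

lemma gaussian_var_integrable:
  assumes "prob_space M" "gaussian_var M X"
  shows "integrable M X"
proof -
  interpret prob_space M by fact
  have [measurable]: "X \<in> borel_measurable M" using assms(2) by (simp add: gaussian_var_def)
  from assms show ?thesis
  proof (cases rule: gaussian_var_cases)
    case (degenerate m)
    then show ?thesis
      by (subst integrable_cong_AE[where g = "\<lambda>_. m"]) auto
  next
    case (normal m \<sigma>)
    show ?thesis
      by (rule distributed_integrable_var[OF normal(2)]) (use integrable_normal_moment_nz_1[OF normal(1)] in auto)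
  qed
qed

lemma gaussian_var_distr:
  assumes N: "N \<in> borel_measurable M" and g: "g \<in> borel_measurable borel"
    and G: "gaussian_var M (\<lambda>\<omega>. g (N \<omega>))"
  shows "gaussian_var (distr M borel N) g"
proof -
  note [measurable] = N g
  have "distr (distr M borel N) borel g = distr M borel (\<lambda>\<omega>. g (N \<omega>))"
    "distr (distr M borel N) lborel g = distr M lborel (\<lambda>\<omega>. g (N \<omega>))"
    by (simp_all add: distr_distr comp_def)
  with G show ?thesis
    by (simp add: gaussian_var_def distributed_def)
qed

lemma centered_gaussian_distr:
  fixes N :: "'a \<Rightarrow> real ^ 'n"
  assumes "prob_space M" "gaussian_vector M N" "\<And>i. (LINT \<omega>|M. N \<omega> $ i) = 0"
  shows "centered_gaussian (distr M borel N)"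
proof -
  interpret prob_space M by fact
  have N [measurable]: "N \<in> borel_measurable M" and G: "gaussian_var M (\<lambda>\<omega>. a \<bullet> N \<omega>)" for a
    using assms(2) by (auto simp: gaussian_vector_def)
  have int: "integrable M (\<lambda>\<omega>. N \<omega> $ i)" for i
    using gaussian_var_integrable[OF assms(1) G[of "axis i 1"]] by (simp add: inner_axis')
  interpret D: prob_space "distr M borel N" by (rule prob_space_distr) simp
  show ?thesis
  proof
    fix a :: "real ^ 'n"
    show "gaussian_var (distr M borel N) (\<lambda>x. a \<bullet> x)"
      by (rule gaussian_var_distr[OF N _ G]) simp
    have "(LINT x|distr M borel N. a \<bullet> x) = (LINT \<omega>|M. (\<Sum>i\<in>UNIV. a $ i * N \<omega> $ i))"
      by (simp add: integral_distr inner_vec_def)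
    also have "\<dots> = 0" using int by (simp add: assms(3))
    finally show "(LINT x|distr M borel N. a \<bullet> x) = 0" .
  qed simp
qed

section \<open>A smooth approximation of the maximum\<close>

definition logsumexp :: "real \<Rightarrow> real ^ 'n \<Rightarrow> real" where
  "logsumexp \<beta> x = ln (\<Sum>i\<in>UNIV. exp (\<beta> * x $ i)) / \<beta>"

text \<open>The gradient of \<open>logsumexp \<beta>\<close>. It is a probability vector at every
  point, which is what confines the covariances of two gradients.\<close>

definition softmax :: "real \<Rightarrow> real ^ 'n \<Rightarrow> real ^ 'n" where
  "softmax \<beta> x = (\<chi> i. exp (\<beta> * x $ i) / (\<Sum>j\<in>UNIV. exp (\<beta> * x $ j)))"

lemma sum_exp_pos: "0 < (\<Sum>i\<in>UNIV. exp (\<beta> * x $ i :: real))" for x :: "real ^ 'n"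
  by (intro sum_pos) auto

lemma softmax_nonneg: "0 \<le> softmax \<beta> x $ i"
  by (simp add: softmax_def sum_nonneg)

lemma sum_softmax: "(\<Sum>i\<in>UNIV. softmax \<beta> x $ i) = 1"
  using sum_exp_pos[of \<beta> x] by (simp add: softmax_def flip: sum_divide_distrib)

lemma norm_softmax_le: "norm (softmax \<beta> x) \<le> 1"
  using norm_le_l1_cart[of "softmax \<beta> x"] by (simp add: softmax_nonneg sum_softmax)

lemma continuous_softmax: "continuous_on UNIV (softmax \<beta> :: real ^ 'n \<Rightarrow> real ^ 'n)"
proof -
  have "(\<Sum>i\<in>UNIV. exp (\<beta> * x $ i)) \<noteq> 0" for x :: "real ^ 'n"
    using sum_exp_pos[of \<beta> x] by linarith
  then show ?thesis
    unfolding softmax_def[abs_def] by (intro continuous_intros) simp_all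
qed

lemma logsumexp_has_derivative:
  fixes x :: "real ^ 'n"
  assumes "\<beta> \<noteq> 0"
  shows "(logsumexp \<beta> has_derivative (\<lambda>h. softmax \<beta> x \<bullet> h)) (at x)"
proof -
  let ?S = "\<lambda>x :: real ^ 'n. \<Sum>i\<in>UNIV. exp (\<beta> * x $ i)"
  have exp: "((\<lambda>x :: real ^ 'n. exp (\<beta> * x $ i)) has_derivative (\<lambda>h. exp (\<beta> * x $ i) * (\<beta> * h $ i))) (at x)" for i
  proof -
    have "((\<lambda>x :: real ^ 'n. \<beta> * x $ i) has_derivative (\<lambda>h. \<beta> * h $ i)) (at x)"
      by (intro bounded_linear_imp_has_derivative bounded_linear_const_mult bounded_linear_vec_nth)
    from has_derivative_compose[OF this DERIV_exp[unfolded has_field_derivative_def]]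
    show ?thesis .
  qed
  have ln: "(ln has_derivative (*) (1 / ?S x)) (at (?S x))"
    using DERIV_ln_divide[OF sum_exp_pos[of \<beta> x]] by (simp add: has_field_derivative_def)
  have "((\<lambda>x. ln (?S x) / \<beta>) has_derivative (\<lambda>h. 1 / ?S x * (\<Sum>i\<in>UNIV. exp (\<beta> * x $ i) * (\<beta> * h $ i)) / \<beta>)) (at x)"
    by (rule bounded_linear.has_derivative[OF bounded_linear_divide has_derivative_compose[OF has_derivative_sum[OF exp] ln]])
  moreover have "1 / ?S x * (\<Sum>i\<in>UNIV. exp (\<beta> * x $ i) * (\<beta> * h $ i)) / \<beta> = softmax \<beta> x \<bullet> h" for h
  proof -
    have "(\<Sum>i\<in>UNIV. exp (\<beta> * x $ i) * (\<beta> * h $ i)) = \<beta> * (\<Sum>i\<in>UNIV. exp (\<beta> * x $ i) * h $ i)"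
      by (simp add: sum_distrib_left mult_ac)
    moreover have "softmax \<beta> x \<bullet> h = (\<Sum>i\<in>UNIV. exp (\<beta> * x $ i) * h $ i) / ?S x"
      by (simp add: inner_vec_def softmax_def sum_divide_distrib)
    ultimately show ?thesis using assms by simp
  qed
  ultimately show ?thesis unfolding logsumexp_def[abs_def] by simp
qed

lemma max_coord_ge: "x $ i \<le> max_coord x"
  unfolding max_coord_def by (rule Max_ge) auto

lemma max_coord_attained: obtains i where "max_coord x = x $ i"
proof -
  have "max_coord x \<in> range (\<lambda>i. x $ i)"
    unfolding max_coord_def by (rule Max_in) auto
  then show ?thesis using that by auto
qed

text \<open>Keep only the largest summand for the lower bound and replace every summand by it for
  the upper one. The gap is uniform in x and vanishes as \<beta> grows.\<close>

lemma logsumexp_bounds: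
  fixes x :: "real ^ 'n"
  assumes "0 < \<beta>"
  shows "max_coord x \<le> logsumexp \<beta> x" "logsumexp \<beta> x \<le> max_coord x + ln (CARD('n)) / \<beta>"
proof -
  obtain k where k: "max_coord x = x $ k" by (rule max_coord_attained)
  have "exp (\<beta> * max_coord x) \<le> (\<Sum>i\<in>UNIV. exp (\<beta> * x $ i))"
    unfolding k by (rule member_le_sum) auto
  then have "\<beta> * max_coord x \<le> ln (\<Sum>i\<in>UNIV. exp (\<beta> * x $ i))"
    using sum_exp_pos[of \<beta> x] by (simp add: ln_ge_iff)
  then show "max_coord x \<le> logsumexp \<beta> x" using assms by (simp add: logsumexp_def field_simps)
  have "(\<Sum>i\<in>UNIV. exp (\<beta> * x $ i)) \<le> (\<Sum>i\<in>(UNIV :: 'n set). exp (\<beta> * max_coord x))"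
    using assms by (intro sum_mono) (simp add: max_coord_ge)
  then have "ln (\<Sum>i\<in>UNIV. exp (\<beta> * x $ i)) \<le> ln (CARD('n) * exp (\<beta> * max_coord x))"
    using sum_exp_pos[of \<beta> x] by simp
  also have "\<dots> = ln (CARD('n)) + \<beta> * max_coord x" by (simp add: ln_mult)
  finally show "logsumexp \<beta> x \<le> max_coord x + ln (CARD('n)) / \<beta>"
    using assms by (simp add: logsumexp_def field_simps)
qed

lemma abs_max_coord_le: "\<bar>max_coord x\<bar> \<le> norm x"
  using max_coord_attained[of x] component_le_norm_cart by metis

lemma logsumexp_tendsto: "(\<lambda>n. logsumexp (real (Suc n)) x) \<longlonglongrightarrow> max_coord x" for x :: "real ^ 'n"
proof (rule tendsto_sandwich)
  show "\<forall>\<^sub>F n in sequentially. max_coord x \<le> logsumexp (real (Suc n)) x"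
    "\<forall>\<^sub>F n in sequentially. logsumexp (real (Suc n)) x \<le> max_coord x + ln (CARD('n)) * (1 / real (Suc n))"
    using logsumexp_bounds[of "real (Suc _)" x] by (auto intro!: always_eventually)
  show "(\<lambda>n. max_coord x + ln (CARD('n)) * (1 / real (Suc n))) \<longlonglongrightarrow> max_coord x"
    using tendsto_add[OF tendsto_const[of "max_coord x"] tendsto_mult[OF tendsto_const LIMSEQ_inverse_real_of_nat[unfolded inverse_eq_divide]], of "ln (CARD('n))"]
    by simp
qed simp

lemma measurable_logsumexp [measurable]: "logsumexp \<beta> \<in> borel_measurable borel"
  unfolding logsumexp_def[abs_def] by measurable

lemma measurable_max_coord [measurable]: "max_coord \<in> borel_measurable (borel :: (real ^ 'n) measure)"
  by (rule borel_measurable_LIMSEQ_real[OF logsumexp_tendsto]) measurable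

lemma probability_vector_bounds:
  fixes p f :: "'i::finite \<Rightarrow> real"
  assumes "\<And>i. 0 \<le> p i" "(\<Sum>i\<in>UNIV. p i) = 1" "\<And>i. l \<le> f i" "\<And>i. f i \<le> u"
  shows "l \<le> (\<Sum>i\<in>UNIV. p i * f i)" "(\<Sum>i\<in>UNIV. p i * f i) \<le> u"
proof -
  have "(\<Sum>i\<in>UNIV. p i * l) \<le> (\<Sum>i\<in>UNIV. p i * f i)" "(\<Sum>i\<in>UNIV. p i * f i) \<le> (\<Sum>i\<in>UNIV. p i * u)"
    using assms by (auto intro!: sum_mono mult_left_mono)
  then show "l \<le> (\<Sum>i\<in>UNIV. p i * f i)" "(\<Sum>i\<in>UNIV. p i * f i) \<le> u"
    using assms(2) by (simp_all flip: sum_distrib_right)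
qed

context centered_gaussian
begin

lemma cov_nonneg: "0 \<le> cov a a"
  unfolding cov_def by simp

text \<open>Nonnegativity of the variance of a - b gives 2 cov a b \<le> cov a a + cov b b. Thus the
  largest variance bounds every entry from above; no such argument exists for the least
  entry.\<close>

lemma cov_le_max: "cov a b \<le> max (cov a a) (cov b b)"
  using cov_nonneg[of "a - b"] by (simp add: cov.diff_left cov.diff_right cov_commute[of b a])

end

section \<open>Stein bounds for the centred maximum\<close>

context
  fixes \<mu> :: "(real ^ 'n) measure" and c C :: real
  assumes gauss: "centered_gaussian \<mu>"
    and c: "0 < c"
    and cC: "\<And>i j. c \<le> centered_gaussian.cov \<mu> (axis i 1) (axis j 1)"
      "\<And>i j. centered_gaussian.cov \<mu> (axis i 1) (axis j 1) \<le> C"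
begin

interpretation centered_gaussian \<mu> by (rule gauss)

text \<open>By bilinearity this is a convex combination, in each argument, of the entries of the
  covariance matrix.\<close>

lemma cov_probability_vectors:
  assumes "\<And>i. 0 \<le> p $ i" "(\<Sum>i\<in>UNIV. p $ i) = 1" "\<And>i. 0 \<le> q $ i" "(\<Sum>i\<in>UNIV. q $ i) = 1"
  shows "c \<le> cov p q" "cov p q \<le> C"
proof -
  have e: "x = (\<Sum>i\<in>UNIV. x $ i *\<^sub>R axis i 1)" for x :: "real ^ 'n"
    by (simp add: vec_eq_iff axis_def if_distrib cong: if_cong)
  have l: "cov p y = (\<Sum>i\<in>UNIV. p $ i * cov (axis i 1) y)" and r: "cov y q = (\<Sum>j\<in>UNIV. q $ j * cov y (axis j 1))" for y
    using arg_cong[OF e[of p], of "\<lambda>v. cov v y"] arg_cong[OF e[of q], of "\<lambda>v. cov y v"]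
    by (simp_all only: cov.sum_left cov.sum_right cov.scaleR_left cov.scaleR_right real_scaleR_def)
  have "cov p q = (\<Sum>i\<in>UNIV. p $ i * (\<Sum>j\<in>UNIV. q $ j * cov (axis i 1) (axis j 1)))"
    by (subst l) (simp only: r)
  moreover have "c \<le> (\<Sum>j\<in>UNIV. q $ j * cov (axis i 1) (axis j 1))"
    "(\<Sum>j\<in>UNIV. q $ j * cov (axis i 1) (axis j 1)) \<le> C" for i
    using probability_vector_bounds[of "\<lambda>j. q $ j" c "\<lambda>j. cov (axis i 1) (axis j 1)" C] assms cC by auto
  ultimately show "c \<le> cov p q" "cov p q \<le> C"
    using probability_vector_bounds[of "\<lambda>i. p $ i" c "\<lambda>i. \<Sum>j\<in>UNIV. q $ j * cov (axis i 1) (axis j 1)" C] assms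
    by auto
qed

text \<open>The covariance formula is applied to \<open>f n\<close> and \<phi>(f n - m). The
  gradient of the latter is \<psi>(f n - m) times a softmax vector, so the bounding functions are c
  and C times \<psi>(f n - m). A covariance ignores constants, so \<open>f n\<close> need not be
  centred and m can be the mean of the maximum itself for every n.\<close>

lemma max_coord_stein_bounds:
  fixes \<psi> \<phi> :: "real \<Rightarrow> real" 
  assumes \<psi>: "\<And>x. isCont \<psi> x" "\<And>x. 0 \<le> \<psi> x" "\<And>x. \<psi> x \<le> 1" and \<phi>: "\<And>x. (\<phi> has_real_derivative \<psi> x) (at x)"
  defines "Z \<equiv> \<lambda>x. max_coord x - (LINT x|\<mu>. max_coord x)"
  shows "c * (LINT x|\<mu>. \<psi> (Z x)) \<le> (LINT x|\<mu>. Z x * \<phi> (Z x))"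
    and "(LINT x|\<mu>. Z x * \<phi> (Z x)) \<le> C * (LINT x|\<mu>. \<psi> (Z x))"
proof -
  define m where "m = (LINT x|\<mu>. max_coord x)"
  have [measurable]: "\<psi> \<in> borel_measurable borel" "\<phi> \<in> borel_measurable borel"
    using \<psi>(1) DERIV_isCont[OF \<phi>] by (auto intro!: borel_measurable_continuous_onI simp: continuous_on_eq_continuous_at)
  have lip: "\<bar>\<phi> x\<bar> \<le> \<bar>\<phi> 0\<bar> + \<bar>x\<bar>" for x
    using field_differentiable_bound[of UNIV \<phi> \<psi> 1 x 0] \<phi> \<psi> by (simp add: has_field_derivative_at_within)
  \<comment> \<open>\<open>Suc n\<close> keeps the parameter at least 1, so the error ln CARD('n) /
    Suc n is bounded uniformly in n.\<close>
  define f where "f n = (logsumexp (real (Suc n)) :: real ^ 'n \<Rightarrow> real)" for n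
  have [measurable]: "f n \<in> borel_measurable borel" for n unfolding f_def by simp
  have lim: "(\<lambda>n. f n x) \<longlonglongrightarrow> max_coord x" for x
    unfolding f_def by (rule logsumexp_tendsto)
  \<comment> \<open>Collects the additive constants in the growth bounds for \<open>f n\<close> and
    \<phi>(f n - m), giving one dominating function for all n.\<close>
  define D where "D = ln (real CARD('n)) + \<bar>\<phi> 0\<bar> + \<bar>m\<bar> + 1"
  have lnc: "0 \<le> ln (real CARD('n))" by simp
  have f_le: "\<bar>f n x\<bar> \<le> ln (real CARD('n)) + norm x" for n x
  proof -
    have "ln (real CARD('n)) / real (Suc n) \<le> ln (real CARD('n))"
      using lnc by (simp add: divide_le_eq mult_left_mono[of 1 "real (Suc n)", simplified] algebra_simps)
    then show ?thesis
      using logsumexp_bounds[of "real (Suc n)" x] abs_max_coord_le[of x] lnc unfolding f_def by (simp del: of_nat_Suc)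
  qed
  have bd: "\<bar>f n x\<bar> \<le> D + norm x" "\<bar>\<phi> (f n x - m)\<bar> \<le> D + norm x" for n x
    using f_le[of n x] lip[of "f n x - m"] by (auto simp: D_def)
  have bd2: "\<bar>f n x * \<phi> (f n x - m)\<bar> \<le> (D + norm x)\<^sup>2" for n x
    unfolding abs_mult power2_eq_square by (rule mult_mono[OF bd]) (use order_trans[OF abs_ge_zero bd(1)] in auto)
  have iw: "integrable \<mu> (\<lambda>x. D + norm x)" "integrable \<mu> (\<lambda>x. (D + norm x)\<^sup>2)"
    using integrable_norm integrable_norm_square by (auto simp: power2_sum)
  have step: "c * (LINT x|\<mu>. \<psi> (f n x - m)) \<le> (LINT x|\<mu>. f n x * \<phi> (f n x - m)) - (LINT x|\<mu>. f n x) * (LINT x|\<mu>. \<phi> (f n x - m))"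
    "(LINT x|\<mu>. f n x * \<phi> (f n x - m)) - (LINT x|\<mu>. f n x) * (LINT x|\<mu>. \<phi> (f n x - m)) \<le> C * (LINT x|\<mu>. \<psi> (f n x - m))" for n
  proof -
    let ?g = "softmax (real (Suc n)) :: real ^ 'n \<Rightarrow> real ^ 'n"
    have df: "(f n has_derivative (\<lambda>h. ?g x \<bullet> h)) (at x)" for x
      unfolding f_def by (rule logsumexp_has_derivative) simp
    have dH: "((\<lambda>x. \<phi> (f n x - m)) has_derivative (\<lambda>h. (\<psi> (f n x - m) *\<^sub>R ?g x) \<bullet> h)) (at x)" for x
    proof -
      have "((\<lambda>x. f n x - m) has_derivative (\<lambda>h. ?g x \<bullet> h)) (at x)"
        using has_derivative_diff[OF df has_derivative_const[of m]] by simp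
      from has_derivative_compose[OF this \<phi>[unfolded has_field_derivative_def]]
      show ?thesis by simp
    qed
    have cf: "continuous_on UNIV (f n)"
      using has_derivative_continuous[OF df] by (simp add: continuous_on_eq_continuous_at)
    have cH: "continuous_on UNIV (\<lambda>x. \<psi> (f n x - m) *\<^sub>R ?g x)"
    proof -
      have "continuous_on UNIV \<psi>" using \<psi>(1) by (simp add: continuous_on_eq_continuous_at)
      then have "continuous_on UNIV (\<lambda>x. \<psi> (f n x - m))"
        by (rule continuous_on_compose2) (auto intro!: continuous_on_diff cf)
      then show ?thesis by (rule continuous_on_scaleR[OF _ continuous_softmax])
    qed
    have nH: "norm (\<psi> (f n x - m) *\<^sub>R ?g x) \<le> 1" for x
      using mult_mono[OF \<psi>(3)[of "f n x - m"] norm_softmax_le[of "real (Suc n)" x]] \<psi>(2) by simp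
    have i\<psi>: "integrable \<mu> (\<lambda>x. \<psi> (f n x - m))"
      by (rule integrable_const_bound[where B = 1]) (use \<psi> in auto)
    have cv: "cov (\<psi> (f n x - m) *\<^sub>R ?g x) (?g y) = \<psi> (f n x - m) * cov (?g x) (?g y)" for x y
      by (simp add: cov.scaleR_left)
    note b = cov_probability_vectors[OF softmax_nonneg sum_softmax softmax_nonneg sum_softmax, of "real (Suc n)" _ "real (Suc n)"]
    have lo: "c * \<psi> (f n x - m) \<le> cov (\<psi> (f n x - m) *\<^sub>R ?g x) (?g y)"
      and hi: "cov (\<psi> (f n x - m) *\<^sub>R ?g x) (?g y) \<le> C * \<psi> (f n x - m)" for x y
      unfolding cv using mult_left_mono[OF b(1)[of x y] \<psi>(2)[of "f n x - m"]]
        mult_left_mono[OF b(2)[of x y] \<psi>(2)[of "f n x - m"]] by (simp_all add: mult.commute)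
    note cb = covariance_bounds[OF df dH continuous_softmax cH norm_softmax_le nH _ _ lo hi]
    show "c * (LINT x|\<mu>. \<psi> (f n x - m)) \<le> (LINT x|\<mu>. f n x * \<phi> (f n x - m)) - (LINT x|\<mu>. f n x) * (LINT x|\<mu>. \<phi> (f n x - m))"
      using cb(1) i\<psi> by simp
    show "(LINT x|\<mu>. f n x * \<phi> (f n x - m)) - (LINT x|\<mu>. f n x) * (LINT x|\<mu>. \<phi> (f n x - m)) \<le> C * (LINT x|\<mu>. \<psi> (f n x - m))"
      using cb(2) i\<psi> by simp
  qed
  have L\<phi>: "(\<lambda>n. \<phi> (f n x - m)) \<longlonglongrightarrow> \<phi> (max_coord x - m)"
    and L\<psi>: "(\<lambda>n. \<psi> (f n x - m)) \<longlonglongrightarrow> \<psi> (max_coord x - m)" for x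
    by (rule isCont_tendsto_compose[OF DERIV_isCont[OF \<phi>]] isCont_tendsto_compose[OF \<psi>(1)];
        intro tendsto_intros lim)+
  have 1: "(\<lambda>n. LINT x|\<mu>. \<psi> (f n x - m)) \<longlonglongrightarrow> (LINT x|\<mu>. \<psi> (max_coord x - m))"
    by (rule integral_dominated_convergence[where w = "\<lambda>_. 1"]) (use \<psi> L\<psi> in auto)
  have 2: "(\<lambda>n. LINT x|\<mu>. \<phi> (f n x - m)) \<longlonglongrightarrow> (LINT x|\<mu>. \<phi> (max_coord x - m))"
    "integrable \<mu> (\<lambda>x. \<phi> (max_coord x - m))"
    by (rule integral_dominated_convergence[where w = "\<lambda>x. D + norm x"]
        integrable_dominated_convergence[where w = "\<lambda>x. D + norm x" and s = "\<lambda>n x. \<phi> (f n x - m)"]; use bd(2) L\<phi> iw in auto)+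
  have 3: "(\<lambda>n. LINT x|\<mu>. f n x) \<longlonglongrightarrow> (LINT x|\<mu>. max_coord x)"
    by (rule integral_dominated_convergence[where w = "\<lambda>x. D + norm x"]) (use bd(1) lim iw in auto)
  have 4: "(\<lambda>n. LINT x|\<mu>. f n x * \<phi> (f n x - m)) \<longlonglongrightarrow> (LINT x|\<mu>. max_coord x * \<phi> (max_coord x - m))"
    "integrable \<mu> (\<lambda>x. max_coord x * \<phi> (max_coord x - m))"
    by (rule integral_dominated_convergence[where w = "\<lambda>x. (D + norm x)\<^sup>2"]
        integrable_dominated_convergence[where w = "\<lambda>x. (D + norm x)\<^sup>2" and s = "\<lambda>n x. f n x * \<phi> (f n x - m)"];
        use bd2 L\<phi> lim iw in \<open>auto intro!: tendsto_mult\<close>)+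
  have eq: "(LINT x|\<mu>. Z x * \<phi> (Z x)) = (LINT x|\<mu>. max_coord x * \<phi> (max_coord x - m)) - (LINT x|\<mu>. max_coord x) * (LINT x|\<mu>. \<phi> (max_coord x - m))"
    using 2(2) 4(2) by (simp add: Z_def m_def algebra_simps)
  have "c * (LINT x|\<mu>. \<psi> (max_coord x - m)) \<le> (LINT x|\<mu>. max_coord x * \<phi> (max_coord x - m)) - (LINT x|\<mu>. max_coord x) * (LINT x|\<mu>. \<phi> (max_coord x - m))"
    by (rule LIMSEQ_le[OF tendsto_mult[OF tendsto_const 1] tendsto_diff[OF 4(1) tendsto_mult[OF 3 2(1)]]])
      (use step(1) in auto)
  then show "c * (LINT x|\<mu>. \<psi> (Z x)) \<le> (LINT x|\<mu>. Z x * \<phi> (Z x))"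
    unfolding eq by (simp add: Z_def m_def)
  have "(LINT x|\<mu>. max_coord x * \<phi> (max_coord x - m)) - (LINT x|\<mu>. max_coord x) * (LINT x|\<mu>. \<phi> (max_coord x - m)) \<le> C * (LINT x|\<mu>. \<psi> (max_coord x - m))"
    by (rule LIMSEQ_le[OF tendsto_diff[OF 4(1) tendsto_mult[OF 3 2(1)]] tendsto_mult[OF tendsto_const 1]])
      (use step(2) in auto)
  then show "(LINT x|\<mu>. Z x * \<phi> (Z x)) \<le> C * (LINT x|\<mu>. \<psi> (Z x))"
    unfolding eq by (simp add: Z_def m_def)
qed

lemma integrable_max_coord: "integrable \<mu> max_coord" "integrable \<mu> (\<lambda>x. (max_coord x)\<^sup>2)"
proof -
  show "integrable \<mu> max_coord"
  proof (rule Bochner_Integration.integrable_bound[OF integrable_norm])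
    show "AE x in \<mu>. norm (max_coord x) \<le> norm (norm x)"
      using abs_max_coord_le by (intro AE_I2) simp
  qed measurable
  have le: "(max_coord x)\<^sup>2 \<le> (norm x)\<^sup>2" for x :: "real ^ 'n"
    using power_mono[OF abs_max_coord_le[of x] abs_ge_zero, of 2] by simp
  show "integrable \<mu> (\<lambda>x. (max_coord x)\<^sup>2)"
  proof (rule Bochner_Integration.integrable_bound[OF integrable_norm_square])
    show "AE x in \<mu>. norm ((max_coord x)\<^sup>2) \<le> norm ((norm x)\<^sup>2)"
      using le by (intro AE_I2) simp
  qed measurable
qed

lemma stein_bounds_max_coord:
  "stein_bounds (distr \<mu> borel (\<lambda>x. max_coord x - (LINT x|\<mu>. max_coord x))) c C"
proof -
  define Z :: "real ^ 'n \<Rightarrow> real" where "Z x = max_coord x - (LINT x|\<mu>. max_coord x)" for x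
  have Z [measurable]: "Z \<in> borel_measurable borel" unfolding Z_def by measurable
  interpret R: real_distribution "distr \<mu> borel Z" by (rule real_distribution_distr) simp
  have "stein_bounds (distr \<mu> borel Z) c C"
  proof
    \<comment> \<open>Index types are nonempty, so an arbitrary entry witnesses c \<le> C.\<close>
    show "0 < C" using c cC[of undefined undefined] by linarith
    show "integrable (distr \<mu> borel Z) (\<lambda>x. x\<^sup>2)" "(LINT x|distr \<mu> borel Z. x) = 0"
      using integrable_max_coord prob_space by (simp_all add: integrable_distr_eq integral_distr Z_def power2_diff)
    fix \<psi> \<phi> :: "real \<Rightarrow> real"
    assume *: "\<And>x. isCont \<psi> x" "\<And>x. 0 \<le> \<psi> x" "\<And>x. \<psi> x \<le> 1" "\<And>x. (\<phi> has_real_derivative \<psi> x) (at x)"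
    have [measurable]: "\<psi> \<in> borel_measurable borel" "\<phi> \<in> borel_measurable borel"
      using *(1) DERIV_isCont[OF *(4)] by (auto intro!: borel_measurable_continuous_onI simp: continuous_on_eq_continuous_at)
    show "(LINT x|distr \<mu> borel Z. x * \<phi> x) \<le> C * (LINT x|distr \<mu> borel Z. \<psi> x)"
      "c * (LINT x|distr \<mu> borel Z. \<psi> x) \<le> (LINT x|distr \<mu> borel Z. x * \<phi> x)"
      using max_coord_stein_bounds[OF *, folded Z_def] by (simp_all add: integral_distr)
  qed (rule c)
  then show ?thesis unfolding Z_def .
qed

end

theorem proposition1p1:
  fixes M :: "'a measure"
    and N :: "'a \<Rightarrow> real ^ 'n"
    and K :: "real ^ 'n ^ 'n"
    and Z :: "'a \<Rightarrow> real"
  assumes "prob_space M"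
    and "gaussian_vector M N"
    and "\<And>i. (\<integral>\<omega>. N \<omega> $ i \<partial>M) = 0"
    and "covariance_matrix M N = K"
    and "\<And>\<omega>. Z \<omega> = max_coord (N \<omega>) - (\<integral>\<eta>. max_coord (N \<eta>) \<partial>M)"
    and "var_min K > 0"
  shows "\<exists>\<rho> :: real \<Rightarrow> real. (\<forall>z. 0 \<le> \<rho> z) \<and>
           distributed M lborel Z (\<lambda>z. ennreal (\<rho> z)) \<and>
           (AE z in lborel.
              (\<integral>\<omega>. \<bar>Z \<omega>\<bar> \<partial>M) / (2 * var_max K) * exp (- z\<^sup>2 / (2 * var_min K)) \<le> \<rho> z \<and>
              \<rho> z \<le> (\<integral>\<omega>. \<bar>Z \<omega>\<bar> \<partial>M) / (2 * var_min K) * exp (- z\<^sup>2 / (2 * var_max K)))"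
proof -
  interpret prob_space M by fact
  have N [measurable]: "N \<in> borel_measurable M" using assms(2) by (simp add: gaussian_vector_def)
  define \<mu> where "\<mu> = distr M borel N"
  have gauss: "centered_gaussian \<mu>"
    unfolding \<mu>_def by (rule centered_gaussian_distr[OF assms(1-3)])
  interpret G: centered_gaussian \<mu> by (rule gauss)
  have K: "G.cov (axis i 1) (axis j 1) = K $ i $ j" for i j
  proof -
    have "G.cov (axis i 1) (axis j 1) = (LINT x|\<mu>. x $ i * x $ j)"
      by (simp add: G.cov_def inner_axis')
    also have "\<dots> = (LINT \<omega>|M. N \<omega> $ i * N \<omega> $ j)"
      unfolding \<mu>_def by (simp add: integral_distr)
    also have "\<dots> = K $ i $ j"
      unfolding assms(4)[symmetric] covariance_matrix_def by (simp add: assms(3))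
    finally show ?thesis .
  qed
  have lo: "var_min K \<le> G.cov (axis i 1) (axis j 1)" for i j
    unfolding K var_min_def by (rule Min_le) (auto intro!: rev_image_eqI[of "(i, j)"])
  have "K $ i $ i \<le> var_max K" for i
    unfolding var_max_def by (rule Max_ge) auto
  \<comment> \<open>The definition of \<open>var_max\<close> sees only the diagonal; off-diagonal
    entries are controlled by the larger of the two variances.\<close>
  then have hi: "G.cov (axis i 1) (axis j 1) \<le> var_max K" for i j
    using G.cov_le_max[of "axis i 1" "axis j 1"] by (simp add: K max_def split: if_splits) (meson order_trans)+
  have Zm: "Z = (\<lambda>\<omega>. max_coord (N \<omega>) - (LINT x|\<mu>. max_coord x))"
    unfolding \<mu>_def using assms(5) by (simp add: integral_distr fun_eq_iff)
  then have [measurable]: "Z \<in> borel_measurable M" by simp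
  have law: "distr \<mu> borel (\<lambda>x. max_coord x - (LINT x|\<mu>. max_coord x)) = distr M borel Z"
    unfolding Zm by (subst (1) \<mu>_def) (simp add: distr_distr comp_def)
  interpret S: stein_bounds "distr M borel Z" "var_min K" "var_max K"
    unfolding law[symmetric] by (rule stein_bounds_max_coord[OF gauss assms(6) lo hi])
  obtain \<rho> :: "real \<Rightarrow> real" where \<rho>: "\<rho> \<in> borel_measurable borel" "\<And>z. 0 \<le> \<rho> z"
    "distr M borel Z = density lborel (\<lambda>z. ennreal (\<rho> z))"
    "AE z in lborel. (LINT x|distr M borel Z. \<bar>x\<bar>) / (2 * var_max K) * exp (- z\<^sup>2 / (2 * var_min K)) \<le> \<rho> z \<and>
       \<rho> z \<le> (LINT x|distr M borel Z. \<bar>x\<bar>) / (2 * var_min K) * exp (- z\<^sup>2 / (2 * var_max K))"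
    by (rule S.gaussian_density_bounds) (rule that)
  have "distr M lborel Z = distr M borel Z" by (rule distr_cong) auto
  then have "distributed M lborel Z (\<lambda>z. ennreal (\<rho> z))"
    using \<rho>(1,3) by (simp add: distributed_def)
  moreover have "(LINT x|distr M borel Z. \<bar>x\<bar>) = (LINT \<omega>|M. \<bar>Z \<omega>\<bar>)"
    by (simp add: integral_distr)
  ultimately show ?thesis using \<rho>(2,4) by auto
qed

end
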